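(* Let $m,n$ be positive integers and $\lambda_a\in\{2,3\}$. Let $\omega=0$ if $\lambda_a=2$, and let $\omega=\xi$ if $\lambda_a=3$, where $\xi$ is the number of subgroups of order $3$ in $\mathbb{Z}_m\times\mathbb{Z}_n$. Then $\Theta(m,n,3,\lambda_a,1)$ is at most \begin{itemize} \item $\left\lfloor\frac{mn+2\omega}{4}\right\rfloor$, if $mn\equiv 1,2,3 \pmod 4$; \item $\left\lfloor\frac{7mn+16\omega}{32}\right\rfloor$, if $mn\equiv 0\pmod 8$ and $\gcd(m,n,2)=1$; \item $\left\lfloor\frac{7mn+4+16\omega}{32}\right\rfloor$, if $mn\equiv 4\pmod 8$, $\gcd(m,n,2)=1$, and $(m,n)\notin\{(12,3),(3,12)\}$; \item $7+\frac{\omega}{2}$, if $(m,n)\in\{(12,3),(3,12)\}$; \item $\left\lfloor\frac{5mn+4+8\omega}{24}\right\rfloor$, if $mn\equiv 4\pmod 8$ and $\gcd(m,n,2)=2$; \item $\left\lfloor\frac{13mn+40+32\omega}{64}\right\rfloor$, if $mn\equiv 8\pmod{16}$, $\gcd(m,n,2)=2$, $(m,n)\notin\{(2,4),(4,2)\}$, and, when $\lambda_a=3$, additionally $(m,n)\notin\{(2,12),(4,6),(6,4),(6,12),(12,2),(12,6)\}$; \item $1$, if $(m,n)\in\{(2,4),(4,2)\}$; \item $\left\lfloor\frac{5mn+8+8\omega}{24}\right\rfloor$, if $(m,n)\in\{(2,12),(4,6),(6,4),(6,12),(12,2),(12,6)\}$ and $\lambda_a=3$; \item $\left\lfloor\frac{13mn+32+32\omega}{64}\right\rfloor$,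 if either $mn\equiv 0\pmod{32}$ and $\gcd(m,n,2)=2$, or $mn\equiv 16\pmod{32}$ and $\gcd(m,n,4)=2$; except for the case in which $mn\equiv 32\pmod{64}$, $\gcd(m,n,8)=4$ and $\lambda_a=2$; \item $\frac{13mn-32}{64}$, if $mn\equiv 32\pmod{64}$, $\gcd(m,n,8)=4$ and $\lambda_a=2$; \item $\left\lfloor\frac{13mn+48+32\omega}{64}\right\rfloor$, if $mn\equiv 16\pmod{32}$ and $\gcd(m,n,4)=4$; except for the case in which $mn\equiv 144\pmod{192}$, $\gcd(m,n,4)=4$ and $\lambda_a=2$; \item $\frac{13mn-16}{64}$, if $mn\equiv 144\pmod{192}$, $\gcd(m,n,4)=4$ and $\lambda_a=2$. \end{itemize}
   Context: For positive integers $m,n,k,\lambda_a,\lambda_c$, an $(m,n,k,\lambda_a,\lambda_c)$ optical orthogonal signature pattern code (OOSPC) is a set $\mathcal F$ of $k$-subsets (codewords) of the group $\mathbb{Z}_m\times\mathbb{Z}_n$ such that (1) $|X\cap (X+g)|\le\lambda_a$ for every $X\in\mathcal F$ and every $g\in\mathbb{Z}_m\times\mathbb{Z}_n\setminus\{(0,0)\}$; (2) $|X\cap(Y+g)|\le\lambda_c$ for all distinct $X,Y\in\mathcal F$ and every $g\in\mathbb{Z}_m\times\mathbb{Z}_n$. (Equivalently, a family of $m\times n$ $(0,1)$-matrices of Hamming weight $k$ with the corresponding periodic auto- and cross-correlation bounds.) $\Theta(m,n,k,\lambda_a,\lambda_c)$ denotes the largest possible number of codewords of an $(m,n,k,\lambda_a,\lambda_c)$-OOSPC.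 Explicitly, $\xi=0$ if $3\nmid mn$, $\xi=1$ if $3\mid mn$ and $\gcd(m,n,3)=1$, and $\xi=4$ if $\gcd(m,n,3)=3$. *)

theory Defs
  imports Complex_Main "HOL-Algebra.Elementary_Groups"
begin

definition Zmn :: "nat \<Rightarrow> nat \<Rightarrow> (int \<times> int) monoid" where
  "Zmn m n = integer_mod_group m \<times>\<times> integer_mod_group n"

text \<open>\<open>Zmn m n\<close> is abelian, so the right coset \<open>X #> g\<close> is the translate \<open>X + g\<close>.\<close>

definition OOSPC ::
    "nat \<Rightarrow> nat \<Rightarrow> nat \<Rightarrow> nat \<Rightarrow> nat \<Rightarrow> (int \<times> int) set set \<Rightarrow> bool" where
  "OOSPC m n k la lc F \<longleftrightarrow>
     (\<forall>X\<in>F. X \<subseteq> carrier (Zmn m n) \<and> card X = k) \<and>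
     (\<forall>X\<in>F. \<forall>g\<in>carrier (Zmn m n) - {\<one>\<^bsub>Zmn m n\<^esub>}.
        card (X \<inter> (X #>\<^bsub>Zmn m n\<^esub> g)) \<le> la) \<and>
     (\<forall>X\<in>F. \<forall>Y\<in>F. X \<noteq> Y \<longrightarrow> (\<forall>g\<in>carrier (Zmn m n).
        card (X \<inter> (Y #>\<^bsub>Zmn m n\<^esub> g)) \<le> lc))"

definition Theta :: "nat \<Rightarrow> nat \<Rightarrow> nat \<Rightarrow> nat \<Rightarrow> nat \<Rightarrow> nat" where
  "Theta m n k la lc = Max {card F |F. OOSPC m n k la lc F}"

definition xi :: "nat \<Rightarrow> nat \<Rightarrow> nat" where
  "xi m n = card {H. subgroup H (Zmn m n) \<and> card H = 3}"

text \<open>For positive \<open>m\<close> and \<open>n\<close> the maximum defining \<^const>\<open>Theta\<close> is taken over a finite nonempty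
  set, so it is attained.\<close>

lemma finite_OOSPC_cards:
  assumes "0 < m" "0 < n"
  shows "finite {card F |F. OOSPC m n k la lc F}" "{card F |F. OOSPC m n k la lc F} \<noteq> {}"
proof -
  have "finite (carrier (Zmn m n))"
    using assms by (simp add: Zmn_def carrier_integer_mod_group)
  then have "finite (card ` Pow (Pow (carrier (Zmn m n))))"
    by simp
  moreover have "{card F |F. OOSPC m n k la lc F} \<subseteq> card ` Pow (Pow (carrier (Zmn m n)))"
    by (auto simp: OOSPC_def)
  ultimately show "finite {card F |F. OOSPC m n k la lc F}"
    by (rule finite_subset[rotated])
  have "OOSPC m n k la lc {}"
    by (simp add: OOSPC_def)
  then show "{card F |F. OOSPC m n k la lc F} \<noteq> {}"
    by blast
qed

lemma Theta_attained:
  assumes "0 < m" "0 < n"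
  obtains F where "OOSPC m n k la lc F" "card F = Theta m n k la lc"
  using Max_in[OF finite_OOSPC_cards[OF assms], of k la lc] unfolding Theta_def by force

end

theory Submission
  imports Defs "HOL-Library.Product_Plus" "HOL-Computational_Algebra.Primes"
begin

text \<open>
  Two distinct codewords never share a difference, so the difference sets \<open>\<Delta>X = {x - y | x \<noteq> y \<in> X}\<close>
  are pairwise disjoint subsets of \<open>G - {0}\<close>. The bounds are linear programming duality for this
  packing: a weight on \<open>G - {0}\<close> giving every \<open>\<Delta>X\<close> at least weight 1 bounds the number of codewords
  by its total. A difference set is \<open>{\<plusminus>a, \<plusminus>b, \<plusminus>(a + b)}\<close>, degenerating to \<open>{\<plusminus>a, \<plusminus>2a}\<close>, or
  to fewer elements in the presence of involutions or elements of order 3. Since doubling moves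
  \<open>G - 2G\<close> into \<open>2G\<close> and \<open>2G\<close> into \<open>4G\<close>, the optimal weight depends essentially on the class
  modulo \<open>4G\<close> only. Each involution lies in at most one difference set, so its weight is raised to cover
  the short codeword using it; cosets of order 3 subgroups are paid for by \<open>\<omega>\<close>. The sporadic
  improvements for \<open>\<lambda>\<^sub>a = 2\<close> come from perturbing an optimal weight, which makes the bound
  strictly smaller than an integer.
\<close>

section \<open>Weights on the differences of a code\<close>

text \<open>Six differences force \<open>w a + w b + w (a + b) \<ge> 1/2\<close> and four force
  \<open>w a + w (a + a) \<ge> 1/2\<close>. If the 2-part is cyclic of order at least 4, these
  balance at 1/8 on odd classes, 3/8 on 2 modulo 4 and 1/4 on \<open>4G\<close>, of mean 7/32. In
  rank two the three nonzero classes modulo \<open>2G\<close> add up to zero, so they share 1/2, as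
  1/6 each or as 1/8, 1/8, 1/4; the mean is 13/64, or 5/24 when \<open>2G\<close> has odd order. The
  constants beside these means come from the at most three involutions. An involution is its own
  negative, so it counts once where other elements count twice and needs extra weight; how much
  depends on its class. Hence \<open>m\<close> and \<open>n\<close> matter modulo 8 although the
  weights are functions modulo 4. A class function cannot single out three elements, so the extra
  weight is a second class function \<open>g\<close>, charged at involutions only and free on
  classes without them. A coset of an order 3 subgroup has just two differences, both in the zero
  class; its shortfall \<open>e\<close> is charged once per such codeword.\<close>

text \<open>\<open>red\<close> picks canonical representatives, so \<open>range red\<close> plays the role of the quotient group by
  \<open>{a. red a = 0}\<close>.\<close>

locale residue_code =
  fixes red :: "'a::ab_group_add \<Rightarrow> 'a" and F :: "'a set set"
  assumes red_0: "red 0 = 0"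
    and red_add: "red (red a + red b) = red (a + b)"
    and finite_range: "finite (range red)"
    and codeword_subset: "X \<in> F \<Longrightarrow> X \<subseteq> range red"
    and card_codeword: "X \<in> F \<Longrightarrow> card X = 3"
    and cross: "\<lbrakk>X \<in> F; Y \<in> F; X \<noteq> Y; x \<in> X; x' \<in> X; x \<noteq> x'; y \<in> Y; y' \<in> Y\<rbrakk>
      \<Longrightarrow> red (x - x') \<noteq> red (y - y')"
begin

definition diffs :: "'a set \<Rightarrow> 'a set" where
  "diffs X = {red (x - y) |x y. x \<in> X \<and> y \<in> X \<and> x \<noteq> y}"

definition pm :: "'a \<Rightarrow> 'a set" where
  "pm a = {red a, red (- a)}"

text \<open>These are the cosets of subgroups of order 3. The set \<open>pm d\<close> determines the
  subgroup, which allows counting by \<open>xi\<close>; invariance under translation by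
  \<open>d\<close> is what contradicts autocorrelation at most 2.\<close>

definition triad :: "'a set \<Rightarrow> bool" where
  "triad X \<longleftrightarrow> (\<exists>d. red d \<noteq> 0 \<and> red (d + d + d) = 0 \<and> diffs X = pm d \<and>
     (\<forall>x\<in>X. red (x + d) \<in> X))"

section \<open>Arithmetic in the quotient\<close>

lemma red_red [simp]: "red (red a) = red a"
  using red_add[of a 0] by (simp add: red_0)

lemma zero_add: "red a = 0 \<Longrightarrow> red b = 0 \<Longrightarrow> red (a + b) = 0"
  using red_add[of a b] by (simp add: red_0)

lemma zero_uminus [simp]: "red (- a) = 0 \<longleftrightarrow> red a = 0"
  using red_add[of a "- a"] red_add[of "- a" a] by (auto simp: red_0)

lemma zero_diff: "red a = 0 \<Longrightarrow> red b = 0 \<Longrightarrow> red (a - b) = 0"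
  using zero_add[of a "- b"] by simp

lemma red_eq_iff: "red a = red b \<longleftrightarrow> red (a - b) = 0"
proof
  assume "red a = red b"
  then have "red (red a + red (- b)) = red (red b + red (- b))" by simp
  then show "red (a - b) = 0" unfolding red_add by (simp add: red_0)
next
  assume "red (a - b) = 0"
  then show "red a = red b" using red_add[of "a - b" b] by simp
qed

lemma pm_cong: "red a = red b \<Longrightarrow> pm a = pm b"
  using red_eq_iff[of "- a" "- b"] red_eq_iff[of b a] by (auto simp: pm_def)

lemma pm_uminus [simp]: "pm (- a) = pm a"
  by (auto simp: pm_def)

lemma pm_disjoint:
  assumes "red (a - b) \<noteq> 0" "red (a + b) \<noteq> 0"
  shows "pm a \<inter> pm b = {}"
proof -
  have "red (- a) \<noteq> red b" "red (- a) \<noteq> red (- b)"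
    using assms zero_uminus[of "a + b"] zero_uminus[of "a - b"] by (auto simp: red_eq_iff)
  with assms show ?thesis
    by (auto simp: pm_def red_eq_iff)
qed

lemma finite_pm [simp]: "finite (pm a)"
  by (simp add: pm_def)

lemma sum_pm:
  fixes w :: "'a \<Rightarrow> real"
  assumes "\<And>a. w (red a) = w a" "\<And>a. w (- a) = w a"
  shows "sum w (pm a) = (if red (a + a) = 0 then w a else 2 * w a)"
proof -
  have "red a = red (- a) \<longleftrightarrow> red (a + a) = 0" by (simp add: red_eq_iff)
  then show ?thesis by (auto simp: pm_def assms)
qed

section \<open>Difference sets of codewords\<close>

lemma diffs_triple:
  assumes "p \<noteq> q" "q \<noteq> r" "p \<noteq> r"
  shows "diffs {p, q, r} = pm (p - q) \<union> pm (q - r) \<union> pm ((p - q) + (q - r))"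
  unfolding diffs_def pm_def using assms by auto

text \<open>For \<open>X = {p, q, r}\<close> take \<open>a = p - q\<close> and
  \<open>b = q - r\<close>. If these agree and have order 3, translation by \<open>a\<close>
  permutes \<open>X\<close> cyclically: \<open>r\<close> to \<open>q\<close> to \<open>p\<close> to
  \<open>r\<close>.\<close>

lemma codeword_diffs:
  assumes "X \<in> F"
  obtains a b where "red a \<noteq> 0" "red b \<noteq> 0" "red (a + b) \<noteq> 0"
    "diffs X = pm a \<union> pm b \<union> pm (a + b)"
    "red (a - b) = 0 \<Longrightarrow> red (a + a + a) = 0 \<Longrightarrow> \<forall>x\<in>X. red (x + a) \<in> X"
proof -
  obtain p q r where X: "X = {p, q, r}" "p \<noteq> q" "q \<noteq> r" "p \<noteq> r"
    using card_codeword[OF assms] by (auto simp: card_3_iff)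
  have rep: "red x = x" if "x \<in> X" for x
    using codeword_subset[OF assms] that by auto
  then have rp: "red p = p" "red q = q" "red r = r" using X by auto
  show thesis
  proof (rule that[of "p - q" "q - r"])
    show "red (p - q) \<noteq> 0" "red (q - r) \<noteq> 0" "red ((p - q) + (q - r)) \<noteq> 0"
      using X rp by (auto simp: red_eq_iff[symmetric])
    show "diffs X = pm (p - q) \<union> pm (q - r) \<union> pm ((p - q) + (q - r))"
      using X diffs_triple by simp
    assume 1: "red ((p - q) - (q - r)) = 0" and 2: "red ((p - q) + (p - q) + (p - q)) = 0"
    have "red (q + (p - q)) = p" using rp by simp
    moreover have "red (r + (p - q)) = red q"
      using 1 by (simp add: red_eq_iff algebra_simps)
    moreover have "red (p + (p - q)) = red r"
      using zero_diff[OF 2 1] by (simp add: red_eq_iff algebra_simps)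
    ultimately show "\<forall>x\<in>X. red (x + (p - q)) \<in> X"
      using X rp by auto
  qed
qed

lemma diffs_subset: "X \<in> F \<Longrightarrow> diffs X \<subseteq> range red - {0}"
proof
  fix d assume X: "X \<in> F" and "d \<in> diffs X"
  then obtain x y where d: "d = red (x - y)" "x \<in> X" "y \<in> X" "x \<noteq> y"
    by (auto simp: diffs_def)
  then have "red x = x" "red y = y" using codeword_subset[OF X] by auto
  then show "d \<in> range red - {0}" using d red_eq_iff[of x y] by auto
qed

lemma diffs_disjoint: "X \<in> F \<Longrightarrow> Y \<in> F \<Longrightarrow> X \<noteq> Y \<Longrightarrow> diffs X \<inter> diffs Y = {}"
  unfolding diffs_def using cross by fastforce

lemma finite_F: "finite F"
proof (rule finite_subset)
  show "F \<subseteq> Pow (range red)" using codeword_subset by auto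
qed (simp add: finite_range)

text \<open>Weak duality: disjointness lets the weights of the difference sets be added up inside
  the group. The number \<open>e\<close> is what a triad may fall short of 1.\<close>

lemma weight_bound:
  fixes w :: "'a \<Rightarrow> real"
  assumes "\<And>a. 0 \<le> w a"
    and "\<And>X. X \<in> F \<Longrightarrow> 1 \<le> sum w (diffs X) + (if triad X then e else 0)"
  shows "real (card F) \<le> sum w (range red - {0}) + e * card {X \<in> F. triad X}"
proof -
  have fin: "finite (diffs X)" if "X \<in> F" for X
    using diffs_subset[OF that] finite_range by (meson finite_Diff finite_subset)
  have "real (card F) = (\<Sum>X\<in>F. 1)" by simp
  also have "\<dots> \<le> (\<Sum>X\<in>F. sum w (diffs X) + (if triad X then e else 0))"
    by (rule sum_mono) (rule assms(2))
  also have "\<dots> = (\<Sum>X\<in>F. sum w (diffs X)) + e * card {X \<in> F. triad X}"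
    using finite_F by (simp add: sum.distrib sum.If_cases Int_def mult.commute)
  also have "(\<Sum>X\<in>F. sum w (diffs X)) = sum w (\<Union>X\<in>F. diffs X)"
    using finite_F fin diffs_disjoint by (intro sum.UNION_disjoint[symmetric]) auto
  also have "\<dots> \<le> sum w (range red - {0})"
    using diffs_subset finite_range by (intro sum_mono2) (auto simp: assms(1))
  finally show ?thesis by simp
qed

text \<open>The hypotheses \<open>w6\<close>, \<open>w5\<close>, \<open>w4\<close>, \<open>w3\<close>, \<open>w2\<close> handle the difference sets with that many elements,
  \<open>w3\<close> being for \<open>{\<plusminus>a, 2a}\<close> with \<open>a\<close> of order 4 and \<open>wK\<close> for the involutions of a Klein four-group.\<close>

lemma diffs_weight:
  fixes w :: "'a \<Rightarrow> real"
  assumes X: "X \<in> F"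
    and nonneg: "\<And>a. 0 \<le> w a" and w: "\<And>a. w (red a) = w a" "\<And>a. w (- a) = w a"
    and w6: "\<And>a b. \<lbrakk>red a \<noteq> 0; red b \<noteq> 0; red (a + b) \<noteq> 0\<rbrakk> \<Longrightarrow> 1 / 2 \<le> w a + w b + w (a + b)"
    and w4: "\<And>a. \<lbrakk>red (a + a) \<noteq> 0; red (a + a + a) \<noteq> 0\<rbrakk> \<Longrightarrow> 1 / 2 \<le> w a + w (a + a)"
    and w3: "\<And>a. \<lbrakk>red (a + a) \<noteq> 0; red ((a + a) + (a + a)) = 0\<rbrakk> \<Longrightarrow> 1 \<le> 2 * w a + w (a + a)"
    and wK: "\<And>a b. \<lbrakk>red a \<noteq> 0; red b \<noteq> 0; red (a + b) \<noteq> 0; red (a + a) = 0; red (b + b) = 0;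
        red ((a + b) + (a + b)) = 0\<rbrakk> \<Longrightarrow> 1 \<le> w a + w b + w (a + b)"
    and w5: "\<And>a b. \<lbrakk>diffs X = pm a \<union> pm b \<union> pm (a + b); red a \<noteq> 0; red (a + a) = 0\<rbrakk>
        \<Longrightarrow> 1 \<le> w a + 2 * w b + 2 * w (a + b)"
    and w2: "\<And>a. \<lbrakk>red a \<noteq> 0; red (a + a + a) = 0\<rbrakk> \<Longrightarrow> 1 - e \<le> 2 * w a"
  shows "1 \<le> sum w (diffs X) + (if triad X then e else 0)"
proof -
  obtain a b where nz: "red a \<noteq> 0" "red b \<noteq> 0" "red (a + b) \<noteq> 0"
    and D: "diffs X = pm a \<union> pm b \<union> pm (a + b)"
    and tr: "red (a - b) = 0 \<Longrightarrow> red (a + a + a) = 0 \<Longrightarrow> \<forall>x\<in>X. red (x + a) \<in> X"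
    using codeword_diffs[OF X] by blast
  note sp = sum_pm[of w, OF w]
  \<comment> \<open>The pairs \<open>pm a\<close>, \<open>pm b\<close>, \<open>pm (a + b)\<close>
    are disjoint unless two of \<open>a\<close>, \<open>b\<close>, \<open>-(a + b)\<close> agree;
    any other coincidence would make one of \<open>a\<close>, \<open>b\<close>, \<open>a + b\<close>
    zero. If two agree, the set collapses to \<open>pm c \<union> pm (c + c)\<close>.\<close>
  show ?thesis
  proof (cases "red (a - b) = 0 \<or> red (a + (a + b)) = 0 \<or> red (b + (a + b)) = 0")
    case True
    have "\<exists>c. diffs X = pm c \<union> pm (c + c) \<and> red c \<noteq> 0 \<and> red (c + c) \<noteq> 0 \<and>
       (red (c + c + c) = 0 \<longrightarrow> (\<forall>x\<in>X. red (x + c) \<in> X))"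
      using True
    proof (elim disjE)
      assume z: "red (a - b) = 0"
      then have "red a = red b" by (simp add: red_eq_iff)
      moreover have "red (a + b) = red (a + a)"
        by (simp add: red_eq_iff) (metis minus_diff_eq z zero_uminus)
      ultimately show ?thesis using D nz tr z by (intro exI[of _ a]) (auto simp: pm_cong[of b a] pm_cong[of "a + b" "a + a"])
    next
      assume z: "red (a + (a + b)) = 0"
      have e1: "red (a + b) = red (- a)" using z by (simp add: red_eq_iff algebra_simps)
      have "- b - (a + a) = - (a + (a + b))" by (simp add: algebra_simps)
      then have e2: "red (- b) = red (a + a)"
        unfolding red_eq_iff using z zero_uminus by metis
      have "red (a - b) = 0" if "red (a + a + a) = 0"
        using zero_diff[OF that z] by (simp add: algebra_simps)
      then show ?thesis using D nz tr pm_cong[OF e1] pm_cong[OF e2] e2 zero_uminus[of b]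
        by (intro exI[of _ a]) auto
    next
      assume z: "red (b + (a + b)) = 0"
      have e1: "red (a + b) = red (- b)" using z by (simp add: red_eq_iff algebra_simps)
      have "- a - (b + b) = - (b + (a + b))" by (simp add: algebra_simps)
      then have e2: "red (- a) = red (b + b)"
        unfolding red_eq_iff using z zero_uminus by metis
      have "\<forall>x\<in>X. red (x + b) \<in> X" if h: "red (b + b + b) = 0"
      proof -
        have ab: "red (a - b) = 0"
          using zero_diff[OF z h] by (simp add: algebra_simps)
        have "red (a + a + a) = 0"
          using zero_add[OF zero_add[OF zero_add[OF ab ab] ab] h] by (simp add: algebra_simps)
        with tr ab have "\<forall>x\<in>X. red (x + a) \<in> X" by blast
        moreover have "red (x + a) = red (x + b)" for x using ab by (simp add: red_eq_iff)
        ultimately show ?thesis by simp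
      qed
      then show ?thesis using D nz pm_cong[OF e1] pm_cong[OF e2] e2 zero_uminus[of a]
        by (intro exI[of _ b]) auto
    qed
    then obtain c where c: "diffs X = pm c \<union> pm (c + c)" "red c \<noteq> 0" "red (c + c) \<noteq> 0"
      and trc: "red (c + c + c) = 0 \<Longrightarrow> \<forall>x\<in>X. red (x + c) \<in> X" by blast
    show ?thesis
    proof (cases "red (c + c + c) = 0")
      case 3: True
      then have "red (c + c) = red (- c)" by (simp add: red_eq_iff)
      then have Dc: "diffs X = pm c" using c pm_cong[of "c + c" "- c"] by simp
      with c 3 trc have "triad X" unfolding triad_def by blast
      with Dc w2[OF c(2) 3] c show ?thesis by (simp add: sp)
    next
      case no3: False
      have "red (c - (c + c)) \<noteq> 0" using c zero_uminus[of c] by simp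
      with no3 have "pm c \<inter> pm (c + c) = {}" by (intro pm_disjoint) (auto simp: add.assoc)
      then have "sum w (diffs X) = sum w (pm c) + sum w (pm (c + c))"
        using c by (simp add: sum.union_disjoint)
      moreover have "\<not> triad X"
      proof
        assume "triad X"
        then obtain d where d: "red (d + d + d) = 0" "diffs X = pm d" unfolding triad_def by blast
        then have "red c \<in> pm d" using c by (auto simp: pm_def)
        then have "red (c - d) = 0 \<or> red (c + d) = 0" by (auto simp: pm_def red_eq_iff)
        then have "red (c + c + c) = 0"
        proof
          assume z: "red (c - d) = 0"
          show ?thesis using zero_add[OF zero_add[OF zero_add[OF z z] z] d(1)] by (simp add: algebra_simps)
        next
          assume z: "red (c + d) = 0"
          show ?thesis using zero_diff[OF zero_add[OF zero_add[OF z z] z] d(1)] by (simp add: algebra_simps)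
        qed
        with no3 show False by simp
      qed
      ultimately show ?thesis using w3[of c] w4[of c] c no3 by (auto simp: sp)
    qed
  next
    case False
    have d1: "pm a \<inter> pm b = {}" using False nz by (intro pm_disjoint) auto
    have "red (a - (a + b)) \<noteq> 0" "red (b - (a + b)) \<noteq> 0"
      using nz zero_uminus[of a] zero_uminus[of b] by simp_all
    then have d2: "pm a \<inter> pm (a + b) = {}" "pm b \<inter> pm (a + b) = {}"
      using False by (auto intro!: pm_disjoint)
    have S: "sum w (diffs X) = sum w (pm a) + sum w (pm b) + sum w (pm (a + b))"
      unfolding D using d1 d2 by (subst sum.union_disjoint; auto simp: sum.union_disjoint)
    have nt: "\<not> triad X"
    proof
      assume "triad X"
      then obtain d where "diffs X = {red d, red (- d)}" by (auto simp: triad_def pm_def)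
      moreover have "red a \<in> diffs X" "red b \<in> diffs X" "red (a + b) \<in> diffs X"
        using D by (auto simp: pm_def)
      moreover have "red a \<noteq> red b" "red a \<noteq> red (a + b)" "red b \<noteq> red (a + b)"
        using d1 d2 by (auto simp: pm_def)
      ultimately show False by auto
    qed
    have ab2: "red ((a + b) + (a + b)) = 0" if "red (a + a) = 0" "red (b + b) = 0"
      using zero_add[OF that] by (simp add: algebra_simps)
    have b2: "red (b + b) = 0" if "red (a + a) = 0" "red ((a + b) + (a + b)) = 0"
      using zero_diff[OF that(2,1)] by (simp add: algebra_simps)
    have a2: "red (a + a) = 0" if "red (b + b) = 0" "red ((a + b) + (a + b)) = 0"
      using zero_diff[OF that(2,1)] by (simp add: algebra_simps)
    have D2: "diffs X = pm b \<union> pm a \<union> pm (b + a)" using D by (auto simp: add.commute)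
    have c5: "1 \<le> w (a + b) + 2 * w b + 2 * w a" if "red ((a + b) + (a + b)) = 0"
    proof -
      have "diffs X = pm (a + b) \<union> pm (- b) \<union> pm ((a + b) + - b)" using D by (auto simp: pm_def)
      from w5[OF this nz(3) that] show ?thesis by (simp add: w)
    qed
    have b5: "1 \<le> w b + 2 * w a + 2 * w (a + b)" if "red (b + b) = 0"
      using w5[OF D2 nz(2) that] by (simp add: add.commute)
    \<comment> \<open>\<open>P\<close>, \<open>Q\<close>, \<open>R\<close> say which of the three
      differences are involutions. Two involutions force the third, so there are none, exactly one,
      or all three.\<close>
    have key: "1 \<le> (if P then x else 2 * x) + (if Q then y else 2 * y) + (if R then z else 2 * z)"
      if "R \<Longrightarrow> 1 \<le> z + 2 * y + 2 * x" "Q \<Longrightarrow> 1 \<le> y + 2 * x + 2 * z" "1 / 2 \<le> x + y + z"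
        "P \<Longrightarrow> Q \<Longrightarrow> R \<Longrightarrow> 1 \<le> x + y + z" "P \<Longrightarrow> 1 \<le> x + 2 * y + 2 * z"
        "P \<Longrightarrow> Q \<Longrightarrow> R" "P \<Longrightarrow> R \<Longrightarrow> Q" "Q \<Longrightarrow> R \<Longrightarrow> P"
      for P Q R and x y z :: real
      using that by (cases P; cases Q; cases R) auto
    have "1 \<le> sum w (diffs X)"
      unfolding S sp
      by (rule key[OF c5 b5 w6[OF nz] wK[OF nz] w5[OF D nz(1)] ab2 b2 a2]; assumption)
    with nt show ?thesis by simp
  qed
qed

text \<open>The weight is \<open>f\<close> everywhere plus \<open>g\<close> on involutions.
  Hypothesis \<open>w5\<close> keeps the codeword \<open>X\<close> because one later weight depends
  on which codeword uses a given involution.\<close>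

lemma card_bound:
  fixes f g :: "'a \<Rightarrow> real"
  assumes f: "\<And>a. 0 \<le> f a" "\<And>a. f (red a) = f a" "\<And>a. f (- a) = f a"
    and g: "\<And>a. 0 \<le> g a" "\<And>a. g (red a) = g a" "\<And>a. g (- a) = g a"
    and w6: "\<And>a b. \<lbrakk>red a \<noteq> 0; red b \<noteq> 0; red (a + b) \<noteq> 0\<rbrakk> \<Longrightarrow> 1 / 2 \<le> f a + f b + f (a + b)"
    and w4: "\<And>a. \<lbrakk>red (a + a) \<noteq> 0; red (a + a + a) \<noteq> 0\<rbrakk> \<Longrightarrow> 1 / 2 \<le> f a + f (a + a)"
    and w3: "\<And>a. \<lbrakk>red (a + a) \<noteq> 0; red ((a + a) + (a + a)) = 0\<rbrakk>
        \<Longrightarrow> 1 \<le> 2 * f a + f (a + a) + g (a + a)"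
    and wK: "\<And>a b. \<lbrakk>red a \<noteq> 0; red b \<noteq> 0; red (a + b) \<noteq> 0; red (a + a) = 0; red (b + b) = 0;
        red ((a + b) + (a + b)) = 0\<rbrakk> \<Longrightarrow> 1 \<le> f a + f b + f (a + b) + g a + g b + g (a + b)"
    and w5: "\<And>X a b. \<lbrakk>X \<in> F; diffs X = pm a \<union> pm b \<union> pm (a + b); red a \<noteq> 0; red (a + a) = 0\<rbrakk>
        \<Longrightarrow> 1 \<le> f a + g a + 2 * f b + 2 * f (a + b)"
    and w2: "\<And>a. \<lbrakk>red a \<noteq> 0; red (a + a + a) = 0\<rbrakk> \<Longrightarrow> 1 - e \<le> 2 * f a"
  shows "real (card F) \<le> sum f (range red - {0}) + sum g {a \<in> range red - {0}. red (a + a) = 0}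
           + e * card {X \<in> F. triad X}"
proof -
  define w where "w a = f a + (if red (a + a) = 0 then g a else 0)" for a
  have wf: "f a \<le> w a" for a using g by (simp add: w_def)
  have "red (red a + red a) = 0 \<longleftrightarrow> red (a + a) = 0" for a by (simp add: red_add)
  moreover have "red (- a + - a) = 0 \<longleftrightarrow> red (a + a) = 0" for a
    using zero_uminus[of "a + a"] by simp
  ultimately have w: "0 \<le> w a" "w (red a) = w a" "w (- a) = w a" for a
    using f g by (auto simp: w_def)
  have "real (card F) \<le> sum w (range red - {0}) + e * card {X \<in> F. triad X}"
  proof (rule weight_bound)
    fix X assume X: "X \<in> F"
    show "1 \<le> sum w (diffs X) + (if triad X then e else 0)"
    proof (rule diffs_weight[OF X w])
      show "1 / 2 \<le> w a + w b + w (a + b)" if "red a \<noteq> 0" "red b \<noteq> 0" "red (a + b) \<noteq> 0" for a b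
        using w6[OF that] wf[of a] wf[of b] wf[of "a + b"] by linarith
      show "1 / 2 \<le> w a + w (a + a)" if "red (a + a) \<noteq> 0" "red (a + a + a) \<noteq> 0" for a
        using w4[OF that] wf[of a] wf[of "a + a"] by linarith
      show "1 \<le> 2 * w a + w (a + a)" if "red (a + a) \<noteq> 0" "red ((a + a) + (a + a)) = 0" for a
        using w3[OF that] wf[of a] that by (simp add: w_def)
      show "1 \<le> w a + w b + w (a + b)"
        if "red a \<noteq> 0" "red b \<noteq> 0" "red (a + b) \<noteq> 0" "red (a + a) = 0" "red (b + b) = 0"
          "red ((a + b) + (a + b)) = 0" for a b
        using wK[OF that] that by (simp add: w_def)
      show "1 \<le> w a + 2 * w b + 2 * w (a + b)"
        if "diffs X = pm a \<union> pm b \<union> pm (a + b)" "red a \<noteq> 0" "red (a + a) = 0" for a b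
        using w5[OF X that] wf[of b] wf[of "a + b"] that by (simp add: w_def)
      show "1 - e \<le> 2 * w a" if "red a \<noteq> 0" "red (a + a + a) = 0" for a
        using w2[OF that] wf[of a] by linarith
    qed
  qed (rule w)
  moreover have "sum w (range red - {0}) =
      sum f (range red - {0}) + sum g {a \<in> range red - {0}. red (a + a) = 0}"
    using finite_range by (subst sum.inter_filter) (simp_all add: w_def sum.distrib)
  ultimately show ?thesis by simp
qed

end

section \<open>Codes in \<open>\<int>\<^sub>m \<times> \<int>\<^sub>n\<close>\<close>

definition red_mod :: "nat \<Rightarrow> nat \<Rightarrow> int \<times> int \<Rightarrow> int \<times> int" where
  "red_mod m n a = (fst a mod int m, snd a mod int n)"

lemma fst_red_mod [simp]: "fst (red_mod m n a) = fst a mod int m"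
  and snd_red_mod [simp]: "snd (red_mod m n a) = snd a mod int n"
  by (simp_all add: red_mod_def)

lemma red_mod_eq_0_iff: "red_mod m n a = 0 \<longleftrightarrow> int m dvd fst a \<and> int n dvd snd a"
  by (auto simp: red_mod_def zero_prod_def mod_eq_0_iff_dvd)

lemma red_mod_add: "red_mod m n (red_mod m n a + red_mod m n b) = red_mod m n (a + b)"
  by (simp add: red_mod_def mod_add_eq)

context
  fixes m n :: nat
  assumes pos: "0 < m" "0 < n"
begin

lemma range_red_mod: "range (red_mod m n) = {0..<int m} \<times> {0..<int n}"
proof
  show "range (red_mod m n) \<subseteq> {0..<int m} \<times> {0..<int n}"
    using pos by (auto simp: red_mod_def)
  have "a = red_mod m n a" if "a \<in> {0..<int m} \<times> {0..<int n}" for a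
    using that by (auto simp: red_mod_def)
  then show "{0..<int m} \<times> {0..<int n} \<subseteq> range (red_mod m n)" by blast
qed

lemma carrier_Zmn: "carrier (Zmn m n) = range (red_mod m n)"
  using pos by (simp add: range_red_mod Zmn_def carrier_integer_mod_group)

lemma mult_Zmn: "a \<otimes>\<^bsub>Zmn m n\<^esub> b = red_mod m n (a + b)"
  using pos by (simp add: Zmn_def red_mod_def DirProd_def integer_mod_group_def split_beta)

lemma r_coset_Zmn: "X #>\<^bsub>Zmn m n\<^esub> g = (\<lambda>x. red_mod m n (x + g)) ` X"
  by (auto simp: r_coset_def mult_Zmn)

lemma one_Zmn: "\<one>\<^bsub>Zmn m n\<^esub> = 0"
  by (simp add: Zmn_def zero_prod_def)

lemma group_Zmn: "group (Zmn m n)"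
  by (simp add: Zmn_def DirProd_group)

lemma inv_Zmn: "a \<in> carrier (Zmn m n) \<Longrightarrow> inv\<^bsub>Zmn m n\<^esub> a = red_mod m n (- a)"
proof (rule group.inv_equality[OF group_Zmn])
  assume a: "a \<in> carrier (Zmn m n)"
  then have "red_mod m n a = a" by (auto simp: carrier_Zmn red_mod_def)
  then show "red_mod m n (- a) \<otimes>\<^bsub>Zmn m n\<^esub> a = \<one>\<^bsub>Zmn m n\<^esub>"
    using red_mod_add[of m n "- a" a] by (simp add: mult_Zmn one_Zmn red_mod_eq_0_iff)
qed (simp_all add: carrier_Zmn)

lemma finite_subgroups_Zmn: "finite {H. subgroup H (Zmn m n) \<and> card H = k}"
proof (rule finite_subset)
  show "{H. subgroup H (Zmn m n) \<and> card H = k} \<subseteq> Pow (carrier (Zmn m n))"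
    by (blast dest: subgroup.subset)
qed (simp add: carrier_Zmn range_red_mod)

text \<open>If \<open>x - x' = y - y'\<close>, then translating \<open>Y\<close> by
  \<open>x - y\<close> carries \<open>y\<close>, \<open>y'\<close> to \<open>x\<close>,
  \<open>x'\<close>, so the translate meets \<open>X\<close> twice, against cross-correlation
  1.\<close>

lemma residue_code_OOSPC:
  assumes "OOSPC m n 3 la 1 F"
  shows "residue_code (red_mod m n) F"
proof
  show "red_mod m n 0 = 0" by (simp add: red_mod_eq_0_iff)
  show "finite (range (red_mod m n))" by (simp add: range_red_mod)
  fix X assume "X \<in> F"
  with assms show "X \<subseteq> range (red_mod m n)" "card X = 3"
    by (auto simp: OOSPC_def carrier_Zmn)
next
  fix X Y x x' y y'
  assume h: "X \<in> F" "Y \<in> F" "X \<noteq> Y" "x \<in> X" "x' \<in> X" "x \<noteq> x'" "y \<in> Y" "y' \<in> Y"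
  have sub: "X \<subseteq> range (red_mod m n)" and fin: "finite X"
    using assms h by (auto simp: OOSPC_def carrier_Zmn card_eq_0_iff intro: card_ge_0_finite)
  have rep: "red_mod m n x = x" "red_mod m n x' = x'"
    using sub h by (auto simp: red_mod_def)
  define g where "g = red_mod m n (x - y)"
  show "red_mod m n (x - x') \<noteq> red_mod m n (y - y')"
  proof
    assume eq: "red_mod m n (x - x') = red_mod m n (y - y')"
    have shift: "red_mod m n (z + g) = red_mod m n (z + (x - y))" for z
      by (simp add: g_def red_mod_def mod_simps)
    have "red_mod m n (y + g) = x"
      by (simp add: shift rep)
    moreover have "red_mod m n (y' + (x - y)) = red_mod m n x'"
      using eq by (auto simp: red_mod_def mod_eq_dvd_iff algebra_simps)
    then have "red_mod m n (y' + g) = x'"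
      by (simp add: shift rep)
    ultimately have "{x, x'} \<subseteq> X \<inter> (Y #>\<^bsub>Zmn m n\<^esub> g)"
      using h unfolding r_coset_Zmn by blast
    then have "card {x, x'} \<le> card (X \<inter> (Y #>\<^bsub>Zmn m n\<^esub> g))"
      using fin by (intro card_mono) auto
    moreover have "card (X \<inter> (Y #>\<^bsub>Zmn m n\<^esub> g)) \<le> 1"
      using assms h unfolding OOSPC_def by (metis carrier_Zmn g_def rangeI)
    ultimately show False using h by simp
  qed
qed (rule red_mod_add)

lemma order_3_subgroup:
  assumes d: "red_mod m n d \<noteq> 0" "red_mod m n (d + d + d) = 0"
  shows "subgroup {0, red_mod m n d, red_mod m n (- d)} (Zmn m n)"
    and "card {0, red_mod m n d, red_mod m n (- d)} = 3"
proof -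
  \<comment> \<open>The empty code gives access to the arithmetic of \<open>red_mod\<close>.\<close>
  interpret residue_code "red_mod m n" "{}"
    by (rule residue_code_OOSPC[of 0]) (simp add: OOSPC_def)
  let ?H = "{0, red_mod m n d, red_mod m n (- d)}"
  have ne: "red_mod m n d \<noteq> red_mod m n (- d)"
  proof
    assume "red_mod m n d = red_mod m n (- d)"
    then have "red_mod m n (d + d) = 0" by (simp add: red_eq_iff)
    from zero_diff[OF d(2) this] d(1) show False by simp
  qed
  have dd: "red_mod m n (d + d) = red_mod m n (- d)"
    using d(2) by (simp add: red_eq_iff)
  have d2: "red_mod m n (- d - d) = red_mod m n d"
    using d(2) zero_uminus[of "d + d + d"] by (simp add: red_eq_iff diff_diff_eq)
  have H: "?H = red_mod m n ` {0, d, - d}"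
    by (auto simp: red_0)
  have ops: "red_mod m n a \<otimes>\<^bsub>Zmn m n\<^esub> red_mod m n b = red_mod m n (a + b)"
    "inv\<^bsub>Zmn m n\<^esub> red_mod m n a = red_mod m n (- a)" for a b
    using red_mod_add[of m n 0 "- a"]
    by (simp_all add: mult_Zmn red_mod_add inv_Zmn carrier_Zmn) (simp add: red_mod_def mod_simps)
  have neg': "red_mod m n (- a) \<in> ?H" if "a \<in> {0, d, - d}" for a
    using that by (elim insertE) (simp_all add: red_0)
  have add': "red_mod m n (a + b) \<in> ?H" if "a \<in> {0, d, - d}" "b \<in> {0, d, - d}" for a b
    using that d2 dd by (elim insertE) (simp_all add: red_0)
  have neg: "inv\<^bsub>Zmn m n\<^esub> u \<in> ?H" and add: "u \<otimes>\<^bsub>Zmn m n\<^esub> v \<in> ?H"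
    if "u \<in> ?H" "v \<in> ?H" for u v
  proof -
    from that obtain a b where "a \<in> {0, d, - d}" "u = red_mod m n a" "b \<in> {0, d, - d}" "v = red_mod m n b"
      unfolding H by blast
    then show "inv\<^bsub>Zmn m n\<^esub> u \<in> ?H" "u \<otimes>\<^bsub>Zmn m n\<^esub> v \<in> ?H"
      by (simp_all only: ops neg' add')
  qed
  show "subgroup ?H (Zmn m n)"
    by (rule group.subgroupI[OF group_Zmn _ _ neg add]) (auto simp only: H carrier_Zmn)
  show "card ?H = 3"
    using ne d(1) by simp
qed

text \<open>For \<open>la = 2\<close> a triad would coincide with its translate by \<open>d\<close>,
  giving autocorrelation 3. For \<open>la = 3\<close>, adjoining 0 to the difference set yields a
  subgroup of order 3, and disjointness of difference sets makes this map injective.\<close>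

lemma card_triad_le:
  assumes code: "OOSPC m n 3 la 1 F" and la: "la \<in> {2, 3}"
  shows "card {X \<in> F. residue_code.triad (red_mod m n) X} \<le> (if la = 2 then 0 else xi m n)"
proof -
  interpret residue_code "red_mod m n" F by (rule residue_code_OOSPC[OF code])
  show ?thesis
  proof (cases "la = 2")
    case True
    have "\<not> triad X" if X: "X \<in> F" for X
    proof
      assume "triad X"
      then obtain d where d: "red_mod m n d \<noteq> 0" "\<forall>x\<in>X. red_mod m n (x + d) \<in> X"
        unfolding triad_def by blast
      have shift: "red_mod m n (x + red_mod m n d) = red_mod m n (x + d)" for x
        by (simp add: red_mod_def mod_simps)
      have img: "X #>\<^bsub>Zmn m n\<^esub> red_mod m n d = (\<lambda>x. red_mod m n (x + d)) ` X"
        by (simp add: r_coset_Zmn shift)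
      have rep: "red_mod m n x = x" if "x \<in> X" for x
        using codeword_subset[OF X] that by auto
      have "inj_on (\<lambda>x. red_mod m n (x + d)) X"
      proof (rule inj_onI)
        fix x y assume "x \<in> X" "y \<in> X" and e: "red_mod m n (x + d) = red_mod m n (y + d)"
        have "red_mod m n x = red_mod m n y" using e by (simp add: red_eq_iff)
        then show "x = y" using rep \<open>x \<in> X\<close> \<open>y \<in> X\<close> by simp
      qed
      then have "card (X \<inter> (X #>\<^bsub>Zmn m n\<^esub> red_mod m n d)) = 3"
        using d card_codeword[OF X] by (simp add: img card_image Int_absorb1 image_subset_iff)
      moreover have "card (X \<inter> (X #>\<^bsub>Zmn m n\<^esub> red_mod m n d)) \<le> la"
        using code X d unfolding OOSPC_def by (simp add: carrier_Zmn one_Zmn)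
      ultimately show False using True by simp
    qed
    then have "{X \<in> F. triad X} = {}" by blast
    then show ?thesis by (metis card.empty le0)
  next
    case False
    let ?h = "\<lambda>X. insert 0 (diffs X)"
    have "card {X \<in> F. triad X} \<le> card {H. subgroup H (Zmn m n) \<and> card H = 3}"
    proof (rule card_inj_on_le)
      show "inj_on ?h {X \<in> F. triad X}"
      proof (rule inj_onI)
        fix X Y assume h: "X \<in> {X \<in> F. triad X}" "Y \<in> {X \<in> F. triad X}" "?h X = ?h Y"
        have "0 \<notin> diffs X" "0 \<notin> diffs Y" "diffs X \<noteq> {}"
          using h diffs_subset by (auto simp: triad_def pm_def)
        then have "diffs X \<inter> diffs Y \<noteq> {}" using h(3) by (metis Int_absorb insert_ident)
        then show "X = Y" using diffs_disjoint h by blast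
      qed
      show "?h ` {X \<in> F. triad X} \<subseteq> {H. subgroup H (Zmn m n) \<and> card H = 3}"
      proof clarify
        fix X assume "X \<in> F" "triad X"
        then obtain d where d: "red_mod m n d \<noteq> 0" "red_mod m n (d + d + d) = 0" "diffs X = pm d"
          unfolding triad_def by blast
        then have "?h X = {0, red_mod m n d, red_mod m n (- d)}" by (auto simp: pm_def)
        then show "subgroup (?h X) (Zmn m n) \<and> card (?h X) = 3"
          using order_3_subgroup[OF d(1,2)] by simp
      qed
      show "finite {H. subgroup H (Zmn m n) \<and> card H = 3}"
        by (rule finite_subgroups_Zmn)
    qed
    with False show ?thesis by (simp add: xi_def)
  qed
qed

end

section \<open>Exchange of the two cyclic factors\<close>

lemma swap_iso_Zmn: "prod.swap \<in> iso (Zmn m n) (Zmn n m)"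
proof -
  have "prod.swap = (\<lambda>(x, y). (y, x))" by auto
  then show ?thesis unfolding Zmn_def using DirProd_commute_iso_set by metis
qed

lemma xi_swap:
  assumes "0 < m" "0 < n"
  shows "xi m n = xi n m"
proof -
  have "xi a b \<le> xi b a" if "0 < a" "0 < b" for a b
    unfolding xi_def
  proof (rule card_inj_on_le)
    interpret group_hom "Zmn a b" "Zmn b a" prod.swap
      using swap_iso_Zmn[of a b] group_Zmn that
      by (simp add: group_hom_def group_hom_axioms_def iso_def)
    show "inj_on ((`) prod.swap) {H. subgroup H (Zmn a b) \<and> card H = 3}"
      by (rule inj_on_subset[of _ UNIV]) (simp_all add: inj_image_eq_iff inj_def)
    show "(`) prod.swap ` {H. subgroup H (Zmn a b) \<and> card H = 3}
        \<subseteq> {H. subgroup H (Zmn b a) \<and> card H = 3}"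
      using subgroup_img_is_subgroup by (auto simp: card_image)
    show "finite {H. subgroup H (Zmn b a) \<and> card H = 3}"
      by (rule finite_subgroups_Zmn[OF that(2,1)])
  qed
  from this[OF assms] this[OF assms(2,1)] show ?thesis by simp
qed

lemma OOSPC_swap:
  assumes mn: "0 < m" "0 < n" and F: "OOSPC m n k la lc F"
  shows "OOSPC n m k la lc ((`) prod.swap ` F)"
proof -
  have carr: "prod.swap g \<in> carrier (Zmn b a)" if "0 < a" "0 < b" "g \<in> carrier (Zmn a b)" for a b g
    using that by (auto simp: carrier_Zmn range_red_mod)
  have tr: "(prod.swap ` Y) #>\<^bsub>Zmn n m\<^esub> g = prod.swap ` (Y #>\<^bsub>Zmn m n\<^esub> prod.swap g)" for Y g
    using mn by (simp add: r_coset_Zmn image_image red_mod_def prod.swap_def)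
  have inter: "card (prod.swap ` X \<inter> (prod.swap ` Y #>\<^bsub>Zmn n m\<^esub> g))
      = card (X \<inter> (Y #>\<^bsub>Zmn m n\<^esub> prod.swap g))" for X Y g
    by (simp add: tr image_Int[symmetric] card_image)
  show ?thesis
    unfolding OOSPC_def
  proof (intro conjI ballI impI)
    fix X assume "X \<in> (`) prod.swap ` F"
    then obtain Y where Y: "Y \<in> F" "X = prod.swap ` Y" by blast
    then have "Y \<subseteq> carrier (Zmn m n)" "card Y = k" using F by (auto simp: OOSPC_def)
    then show "X \<subseteq> carrier (Zmn n m)" "card X = k"
      using Y carr[OF mn] by (auto simp only: card_image inj_swap)
    fix g assume g: "g \<in> carrier (Zmn n m) - {\<one>\<^bsub>Zmn n m\<^esub>}"
    then have "prod.swap g \<in> carrier (Zmn m n) - {\<one>\<^bsub>Zmn m n\<^esub>}"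
      using carr[OF mn(2,1), of g] mn by (cases g) (auto simp: one_Zmn zero_prod_def)
    then show "card (X \<inter> (X #>\<^bsub>Zmn n m\<^esub> g)) \<le> la"
      using F Y unfolding OOSPC_def by (simp add: inter)
  next
    fix X X' g
    assume "X \<in> (`) prod.swap ` F" "X' \<in> (`) prod.swap ` F" "X \<noteq> X'"
      and g: "g \<in> carrier (Zmn n m)"
    then obtain Y Y' where "Y \<in> F" "X = prod.swap ` Y" "Y' \<in> F" "X' = prod.swap ` Y'" "Y \<noteq> Y'"
      by blast
    then show "card (X \<inter> (X' #>\<^bsub>Zmn n m\<^esub> g)) \<le> lc"
      using F carr[OF mn(2,1) g] unfolding OOSPC_def by (simp add: inter)
  qed
qed

lemma Theta_swap:
  assumes "0 < m" "0 < n"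
  shows "Theta m n k la lc = Theta n m k la lc"
proof -
  have "Theta a b k la lc \<le> Theta b a k la lc" if ab: "0 < a" "0 < b" for a b
  proof -
    obtain F where F: "OOSPC a b k la lc F" "card F = Theta a b k la lc"
      by (rule Theta_attained[OF ab])
    have "card ((`) prod.swap ` F) = card F"
      by (rule card_image, rule inj_on_subset[of _ UNIV]) (simp_all add: inj_image_eq_iff inj_def)
    with F OOSPC_swap[OF ab F(1)] have "Theta a b k la lc \<in> {card F |F. OOSPC b a k la lc F}"
      by (metis (mono_tags, lifting) mem_Collect_eq)
    then show ?thesis
      unfolding Theta_def[of b a] by (rule Max_ge[OF finite_OOSPC_cards(1)[OF ab(2,1)]])
  qed
  from this[OF assms] this[OF assms(2,1)] show ?thesis by simp
qed

section \<open>Weights given by residue classes\<close>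

lemma sum_mod_periodic:
  fixes \<phi> :: "int \<Rightarrow> real"
  assumes "0 < p"
  shows "(\<Sum>x\<in>{0..<p * int k}. \<phi> (x mod p)) = real k * (\<Sum>x\<in>{0..<p}. \<phi> x)"
proof (induction k)
  case (Suc k)
  have shift: "x mod p = x - p * int k" if "p * int k \<le> x" "x < p * int k + p" for x
  proof -
    have "x mod p = (x - p * int k + p * int k) mod p" by simp
    also have "\<dots> = (x - p * int k) mod p" by (simp only: mod_mult_self2)
    finally show ?thesis using that by simp
  qed
  have "0 \<le> p * int k" using assms by simp
  then have "{0..<p * int (Suc k)} = {0..<p * int k} \<union> {p * int k..<p * int k + p}"
    using assms by (simp add: ivl_disj_un_two distrib_left add.commute)
  then have "(\<Sum>x\<in>{0..<p * int (Suc k)}. \<phi> (x mod p))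
    = (\<Sum>x\<in>{0..<p * int k}. \<phi> (x mod p)) + (\<Sum>x\<in>{p * int k..<p * int k + p}. \<phi> (x mod p))"
    by (simp add: sum.union_disjoint)
  also have "(\<Sum>x\<in>{p * int k..<p * int k + p}. \<phi> (x mod p)) = (\<Sum>x\<in>{0..<p}. \<phi> x)"
    by (rule sum.reindex_bij_witness[of _ "\<lambda>x. x + p * int k" "\<lambda>x. x - p * int k"])
      (auto simp: shift)
  finally show ?case using Suc.IH by (simp add: algebra_simps)
qed simp

lemma range_red_mod_involutions:
  assumes "0 < m" "0 < n"
  defines "H \<equiv> \<lambda>k::nat. if even k then {0, int (k div 2)} else {0}"
  shows "{a \<in> range (red_mod m n) - {0}. red_mod m n (a + a) = 0} = H m \<times> H n - {(0, 0)}"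
proof -
  have "x \<in> H k \<longleftrightarrow> 0 \<le> x \<and> x < int k \<and> int k dvd x + x" if k: "0 < k" for x :: int and k :: nat
  proof
    assume "x \<in> H k"
    then show "0 \<le> x \<and> x < int k \<and> int k dvd x + x"
      using k by (auto simp: H_def split: if_splits elim!: evenE)
  next
    assume h: "0 \<le> x \<and> x < int k \<and> int k dvd x + x"
    then obtain c where c: "x + x = int k * c" by blast
    have "0 \<le> int k * c" "int k * c < int k * 2" using h c by linarith+
    then have "0 \<le> c" "c < 2" using k by (simp_all add: zero_le_mult_iff)
    then have "c = 0 \<or> c = 1" by linarith
    then show "x \<in> H k" using c by (auto simp: H_def) presburger+
  qed
  then show ?thesis
    using assms(1,2) by (auto simp: range_red_mod red_mod_eq_0_iff[unfolded zero_prod_def] zero_prod_def)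
qed

text \<open>The involutions are listed explicitly as halves of \<open>m\<close> and
  \<open>n\<close>. The order conditions kept in \<open>w4\<close>, \<open>w3\<close>,
  \<open>w5\<close> and \<open>w2\<close> are those that a weight finer than a class function, or a
  closer look at the classes, can exploit.\<close>

lemma OOSPC_card_bound:
  fixes f g :: "int \<times> int \<Rightarrow> real"
  assumes mn: "0 < m" "0 < n" and code: "OOSPC m n 3 la 1 F" and la: "la \<in> {2, 3}"
    and \<omega>: "\<omega> = (if la = 2 then 0 else xi m n)" and "0 \<le> e"
    and f: "\<And>a. 0 \<le> f a" "\<And>a. f (red_mod m n a) = f a" "\<And>a. f (- a) = f a"
    and g: "\<And>a. 0 \<le> g a" "\<And>a. g (red_mod m n a) = g a" "\<And>a. g (- a) = g a"
    and w6: "\<And>a b. 1 / 2 \<le> f a + f b + f (a + b)"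
    and w4: "\<And>a. \<lbrakk>red_mod m n (a + a) \<noteq> 0; red_mod m n (a + a + a) \<noteq> 0\<rbrakk> \<Longrightarrow> 1 / 2 \<le> f a + f (a + a)"
    and w3: "\<And>a. \<lbrakk>red_mod m n (a + a) \<noteq> 0; red_mod m n ((a + a) + (a + a)) = 0\<rbrakk>
        \<Longrightarrow> 1 \<le> 2 * f a + f (a + a) + g (a + a)"
    and wK: "\<And>a b. 1 \<le> f a + f b + f (a + b) + g a + g b + g (a + b)"
    and w5: "\<And>X a b. \<lbrakk>X \<in> F; residue_code.diffs (red_mod m n) X =
          residue_code.pm (red_mod m n) a \<union> residue_code.pm (red_mod m n) b \<union>
          residue_code.pm (red_mod m n) (a + b); red_mod m n a \<noteq> 0; red_mod m n (a + a) = 0\<rbrakk>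
        \<Longrightarrow> 1 \<le> f a + g a + 2 * f b + 2 * f (a + b)"
    and w2: "\<And>a. \<lbrakk>red_mod m n a \<noteq> 0; red_mod m n (a + a + a) = 0\<rbrakk> \<Longrightarrow> 1 - e \<le> 2 * f a"
  shows "real (card F) \<le> sum f ({0..<int m} \<times> {0..<int n}) - f 0
    + (if even n then g (0, int (n div 2)) else 0) + (if even m then g (int (m div 2), 0) else 0)
    + (if even m \<and> even n then g (int (m div 2), int (n div 2)) else 0) + e * \<omega>"
proof -
  interpret residue_code "red_mod m n" F by (rule residue_code_OOSPC[OF mn code])
  have "real (card F) \<le> sum f (range (red_mod m n) - {0})
      + sum g {a \<in> range (red_mod m n) - {0}. red_mod m n (a + a) = 0} + e * card {X \<in> F. triad X}"
    by (rule card_bound) (use assms in auto)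
  also have "e * card {X \<in> F. triad X} \<le> e * \<omega>"
    using card_triad_le[OF mn code la] \<omega> \<open>0 \<le> e\<close> by (intro mult_left_mono) auto
  also have "sum f (range (red_mod m n) - {0}) = sum f ({0..<int m} \<times> {0..<int n}) - f 0"
    using mn by (simp add: range_red_mod sum_diff1 zero_prod_def)
  also have "sum g {a \<in> range (red_mod m n) - {0}. red_mod m n (a + a) = 0} =
    (if even n then g (0, int (n div 2)) else 0) + (if even m then g (int (m div 2), 0) else 0)
    + (if even m \<and> even n then g (int (m div 2), int (n div 2)) else 0)"
  proof -
    have "m div 2 \<noteq> 0" if "even m" using that mn by presburger
    moreover have "n div 2 \<noteq> 0" if "even n" using that mn by presburger
    ultimately show ?thesis
      unfolding range_red_mod_involutions[OF mn]
      by (auto simp: sum_diff1 sum.cartesian_product[symmetric])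
  qed
  finally show ?thesis by simp
qed

lemma sum_mod_box:
  fixes \<phi> :: "int \<Rightarrow> int \<Rightarrow> real"
  assumes "0 < p" "0 < q" "int m = p * int m'" "int n = q * int n'"
  shows "(\<Sum>a\<in>{0..<int m} \<times> {0..<int n}. \<phi> (fst a mod p) (snd a mod q))
    = real (m' * n') * (\<Sum>r\<in>{0..<p}. \<Sum>s\<in>{0..<q}. \<phi> r s)"
proof -
  have "(\<Sum>a\<in>{0..<int m} \<times> {0..<int n}. \<phi> (fst a mod p) (snd a mod q))
    = (\<Sum>x\<in>{0..<int m}. \<Sum>y\<in>{0..<int n}. \<phi> (x mod p) (y mod q))"
    by (simp add: sum.cartesian_product split_beta)
  also have "\<dots> = (\<Sum>x\<in>{0..<int m}. real n' * (\<Sum>s\<in>{0..<q}. \<phi> (x mod p) s))"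
    using sum_mod_periodic[OF assms(2)] by (simp add: assms)
  also have "\<dots> = real m' * (\<Sum>r\<in>{0..<p}. real n' * (\<Sum>s\<in>{0..<q}. \<phi> r s))"
    using sum_mod_periodic[OF assms(1), of "\<lambda>r. real n' * (\<Sum>s\<in>{0..<q}. \<phi> r s)"] by (simp add: assms)
  finally show ?thesis by (simp add: sum_distrib_left mult.assoc)
qed

definition on_class :: "int \<Rightarrow> int \<Rightarrow> (int \<Rightarrow> int \<Rightarrow> real) \<Rightarrow> int \<times> int \<Rightarrow> real" where
  "on_class p q h a = h (fst a mod p) (snd a mod q)"

lemma on_class_add: "on_class p q h (a + b) =
    h ((fst a mod p + fst b mod p) mod p) ((snd a mod q + snd b mod q) mod q)"
  by (simp add: on_class_def mod_add_eq)

lemma on_class_uminus: "on_class p q h (- a) = h (- (fst a mod p) mod p) (- (snd a mod q) mod q)"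
  by (simp add: on_class_def mod_minus_eq)

lemma on_class_red_mod:
  "int m = p * k \<Longrightarrow> int n = q * l \<Longrightarrow> on_class p q h (red_mod m n a) = on_class p q h a"
  by (simp add: on_class_def mod_mod_cancel)

lemma dvd_triple_imp_dvd:
  fixes p x :: int
  assumes "\<not> 3 dvd p" "p dvd 3 * x"
  shows "p dvd x"
proof -
  have "coprime 3 p" using assms(1) by (intro prime_imp_coprime) simp_all
  then show ?thesis using assms(2) by (simp add: coprime_dvd_mult_right_iff coprime_commute)
qed

text \<open>Reduces a bound to finitely many inequalities between residues. Each class has
  \<open>m' * n'\<close> members. As 3 divides neither modulus, elements of order 3 lie in the class
  (0, 0), so the shortfall is governed by \<open>f 0 0\<close> alone.\<close>

lemma class_card_bound:
  fixes f g :: "int \<Rightarrow> int \<Rightarrow> real" and p q :: int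
  assumes mn: "0 < m" "0 < n" and code: "OOSPC m n 3 la 1 F" and la: "la \<in> {2, 3}"
    and \<omega>: "\<omega> = (if la = 2 then 0 else xi m n)" and e: "0 \<le> e"
    and p: "0 < p" "\<not> 3 dvd p" "int m = p * int m'"
    and q: "0 < q" "\<not> 3 dvd q" "int n = q * int n'"
    and nonneg: "\<And>r s. 0 \<le> f r s" "\<And>r s. 0 \<le> g r s"
    and even: "\<And>r s. r \<in> {0..<p} \<Longrightarrow> s \<in> {0..<q} \<Longrightarrow> f (- r mod p) (- s mod q) = f r s"
      "\<And>r s. r \<in> {0..<p} \<Longrightarrow> s \<in> {0..<q} \<Longrightarrow> g (- r mod p) (- s mod q) = g r s"
    and w6: "\<And>r s t u. r \<in> {0..<p} \<Longrightarrow> s \<in> {0..<q} \<Longrightarrow> t \<in> {0..<p} \<Longrightarrow> u \<in> {0..<q} \<Longrightarrow>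
      1 / 2 \<le> f r s + f t u + f ((r + t) mod p) ((s + u) mod q)"
    and w4: "\<And>r s. r \<in> {0..<p} \<Longrightarrow> s \<in> {0..<q} \<Longrightarrow> 1 / 2 \<le> f r s + f ((r + r) mod p) ((s + s) mod q)"
    and w3: "\<And>r s. r \<in> {0..<p} \<Longrightarrow> s \<in> {0..<q} \<Longrightarrow>
      1 \<le> 2 * f r s + f ((r + r) mod p) ((s + s) mod q) + g ((r + r) mod p) ((s + s) mod q)"
    and wK: "\<And>r s t u. r \<in> {0..<p} \<Longrightarrow> s \<in> {0..<q} \<Longrightarrow> t \<in> {0..<p} \<Longrightarrow> u \<in> {0..<q} \<Longrightarrow>
      1 \<le> f r s + f t u + f ((r + t) mod p) ((s + u) mod q) + g r s + g t u
         + g ((r + t) mod p) ((s + u) mod q)"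
    and w5: "\<And>r s t u. r \<in> {0..<p} \<Longrightarrow> s \<in> {0..<q} \<Longrightarrow> t \<in> {0..<p} \<Longrightarrow> u \<in> {0..<q} \<Longrightarrow>
      1 \<le> f r s + g r s + 2 * f t u + 2 * f ((r + t) mod p) ((s + u) mod q)"
    and w2: "1 - e \<le> 2 * f 0 0"
  shows "real (card F) \<le> real (m' * n') * (\<Sum>r\<in>{0..<p}. \<Sum>s\<in>{0..<q}. f r s) - f 0 0
    + (if even n then g 0 (int (n div 2) mod q) else 0)
    + (if even m then g (int (m div 2) mod p) 0 else 0)
    + (if even m \<and> even n then g (int (m div 2) mod p) (int (n div 2) mod q) else 0) + e * \<omega>"
proof -
  have range: "x mod p \<in> {0..<p}" "x mod q \<in> {0..<q}" for x
    using p q by simp_all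
  have "real (card F) \<le> sum (on_class p q f) ({0..<int m} \<times> {0..<int n}) - on_class p q f 0
    + (if even n then on_class p q g (0, int (n div 2)) else 0) + (if even m then on_class p q g (int (m div 2), 0) else 0)
    + (if even m \<and> even n then on_class p q g (int (m div 2), int (n div 2)) else 0) + e * \<omega>"
  proof (rule OOSPC_card_bound[OF mn code la \<omega> e])
    fix a :: "int \<times> int"
    assume "red_mod m n (a + a + a) = 0"
    then have "p dvd 3 * fst a" "q dvd 3 * snd a"
      using dvd_mult_left by (auto simp: red_mod_eq_0_iff p(3) q(3))
    then have "p dvd fst a" "q dvd snd a"
      using p(2) q(2) by (auto intro: dvd_triple_imp_dvd)
    then have "fst a mod p = 0" "snd a mod q = 0" by simp_all
    then show "1 - e \<le> 2 * on_class p q f a" using w2 by (simp add: on_class_def)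
  qed (use nonneg even w6 w4 w3 wK w5 range in \<open>simp_all only: on_class_red_mod[OF p(3) q(3)] on_class_add on_class_uminus\<close>,
      simp_all add: on_class_def)
  moreover have "sum (on_class p q f) ({0..<int m} \<times> {0..<int n})
      = real (m' * n') * (\<Sum>r\<in>{0..<p}. \<Sum>s\<in>{0..<q}. f r s)"
    using sum_mod_box[OF p(1) q(1) p(3) q(3), of f] by (simp add: on_class_def)
  moreover have "on_class p q f 0 = f 0 0" "on_class p q g (x, y) = g (x mod p) (y mod q)" for x y
    by (simp_all add: on_class_def)
  ultimately show ?thesis by (cases "even m"; cases "even n") simp_all
qed

section \<open>One weight for each 2-adic type of the group\<close>

lemma residues_1: "{0..<1::int} = {0}" by auto
lemma residues_2: "{0..<2::int} = {0, 1}" by auto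
lemma residues_4: "{0..<4::int} = {0, 1, 2, 3}" by auto

lemmas residues = residues_1 residues_2 residues_4

text \<open>The weight is constantly 1/4. There is at most one involution, and its surplus 1/4 is
  offset by the omitted weight of 0.\<close>

lemma class_card_bound_1_1:
  assumes mn: "0 < m" "0 < n" and code: "OOSPC m n 3 la 1 F" and la: "la \<in> {2, 3}"
    and \<omega>: "\<omega> = (if la = 2 then 0 else xi m n)" and N: "m * n mod 4 \<in> {1, 2, 3}"
  shows "real (card F) \<le> (real (m * n) + 2 * real \<omega>) / 4"
proof -
  have "\<not> (even m \<and> even n)"
  proof
    assume "even m \<and> even n"
    then have "m * n mod 4 = 0" by (auto elim!: evenE)
    with N show False by simp
  qed
  with class_card_bound[OF mn code la \<omega>, of "1 / 2" 1 m 1 n "\<lambda>_ _. 1 / 4" "\<lambda>_ _. 1 / 4"]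
  show ?thesis by (auto simp: residues_1 split: if_splits)
qed

text \<open>The involution lies in class 2 and is twice an odd element of order 4, whence the
  surplus 3/8: \<open>2/8 + 3/8 + 3/8 = 1\<close>. The constant is \<open>3/8 - 1/4 = 4/32\<close>.
  Here and below, \<open>g = 1\<close> is a filler on classes without involutions, where it makes
  the inequalities hold at no cost.\<close>

lemma class_card_bound_1_4:
  assumes mn: "0 < m" "0 < n" and code: "OOSPC m n 3 la 1 F" and la: "la \<in> {2, 3}"
    and \<omega>: "\<omega> = (if la = 2 then 0 else xi m n)" and m: "odd m" and n: "n mod 8 = 4"
  shows "real (card F) \<le> (7 * real (m * n) + 4 + 16 * real \<omega>) / 32"
proof -
  define f :: "int \<Rightarrow> int \<Rightarrow> real" where "f r s = (if odd s then 1/8 else if s = 2 then 3/8 else 1/4)" for r s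
  define g :: "int \<Rightarrow> int \<Rightarrow> real" where "g r s = (if s = 2 then 3/8 else 1)" for r s
  obtain k where k: "n = 8 * k + 4" using n by (metis mult_div_mod_eq)
  have "real (card F) \<le> real (m * (2 * k + 1)) * (\<Sum>r\<in>{0..<1}. \<Sum>s\<in>{0..<4}. f r s) - f 0 0
    + (if even n then g 0 (int (n div 2) mod 4) else 0)
    + (if even m then g (int (m div 2) mod 1) 0 else 0)
    + (if even m \<and> even n then g (int (m div 2) mod 1) (int (n div 2) mod 4) else 0) + 1/2 * \<omega>"
    by (rule class_card_bound[OF mn code la \<omega>]; (simp only: residues)?; (auto simp: f_def g_def k)?)
  then show ?thesis using m by (simp add: residues f_def g_def k algebra_simps)
qed

text \<open>Now the involution lies in class 0, and its surplus 1/4 cancels the omitted weight of 0.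
  The tight case of \<open>w5\<close> has \<open>b\<close> odd:
  \<open>1/4 + 1/4 + 4/8 = 1\<close>.\<close>

lemma class_card_bound_1_8:
  assumes mn: "0 < m" "0 < n" and code: "OOSPC m n 3 la 1 F" and la: "la \<in> {2, 3}"
    and \<omega>: "\<omega> = (if la = 2 then 0 else xi m n)" and m: "odd m" and n: "n mod 8 = 0"
  shows "real (card F) \<le> (7 * real (m * n) + 16 * real \<omega>) / 32"
proof -
  define f :: "int \<Rightarrow> int \<Rightarrow> real" where "f r s = (if odd s then 1/8 else if s = 2 then 3/8 else 1/4)" for r s
  define g :: "int \<Rightarrow> int \<Rightarrow> real" where "g r s = (if s = 0 then 1/4 else 1)" for r s
  obtain k where k: "n = 8 * k" using n by auto
  have "real (card F) \<le> real (m * (2 * k)) * (\<Sum>r\<in>{0..<1}. \<Sum>s\<in>{0..<4}. f r s) - f 0 0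
    + (if even n then g 0 (int (n div 2) mod 4) else 0)
    + (if even m then g (int (m div 2) mod 1) 0 else 0)
    + (if even m \<and> even n then g (int (m div 2) mod 1) (int (n div 2) mod 4) else 0) + 1/2 * \<omega>"
    by (rule class_card_bound[OF mn code la \<omega>]; (simp only: residues)?; (auto simp: f_def g_def k)?)
  then show ?thesis using m by (simp add: residues f_def g_def k algebra_simps)
qed

text \<open>Here \<open>2G\<close> has odd order, so classes modulo 2 suffice. The three involutions
  lie in the three odd classes with total weight 1/3 each, which is tight for the Klein four-group.
  The constant is \<open>3/6 - 1/3 = 4/24\<close>, and \<open>f 0 0 = 1/3\<close> gives
  \<open>e = 1/3\<close>.\<close>

lemma class_card_bound_2_2:
  assumes mn: "0 < m" "0 < n" and code: "OOSPC m n 3 la 1 F" and la: "la \<in> {2, 3}"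
    and \<omega>: "\<omega> = (if la = 2 then 0 else xi m n)" and m: "m mod 4 = 2" and n: "n mod 4 = 2"
  shows "real (card F) \<le> (5 * real (m * n) + 4 + 8 * real \<omega>) / 24"
proof -
  define f :: "int \<Rightarrow> int \<Rightarrow> real" where "f r s = (if odd r \<or> odd s then 1/6 else 1/3)" for r s
  define g :: "int \<Rightarrow> int \<Rightarrow> real" where "g r s = (if odd r \<or> odd s then 1/6 else 1)" for r s
  obtain j where j: "m = 4 * j + 2" using m by (metis mult_div_mod_eq)
  obtain k where k: "n = 4 * k + 2" using n by (metis mult_div_mod_eq)
  have "real (card F) \<le> real ((2 * j + 1) * (2 * k + 1)) * (\<Sum>r\<in>{0..<2}. \<Sum>s\<in>{0..<2}. f r s) - f 0 0
    + (if even n then g 0 (int (n div 2) mod 2) else 0)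
    + (if even m then g (int (m div 2) mod 2) 0 else 0)
    + (if even m \<and> even n then g (int (m div 2) mod 2) (int (n div 2) mod 2) else 0) + 1/3 * \<omega>"
    by (rule class_card_bound[OF mn code la \<omega>]; (simp only: residues)?; (auto simp: f_def g_def j k)?)
  then show ?thesis  by (simp add: residues f_def g_def j k algebra_simps)
qed

text \<open>The involution in class (0, 2) is a double of elements of order 4:
  \<open>2/8 + 3/4 = 1\<close>. The other two, in classes (1, 0) and (1, 2), get total weight 1/2,
  tight in \<open>w5\<close> against odd second coordinates: \<open>1/2 + 4/8 = 1\<close>. The
  constant is \<open>3/8 + 1/4 + 1/4 - 1/4 = 40/64\<close>.\<close>

lemma class_card_bound_2_4:
  assumes mn: "0 < m" "0 < n" and code: "OOSPC m n 3 la 1 F" and la: "la \<in> {2, 3}"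
    and \<omega>: "\<omega> = (if la = 2 then 0 else xi m n)" and m: "m mod 4 = 2" and n: "n mod 8 = 4"
  shows "real (card F) \<le> (13 * real (m * n) + 40 + 32 * real \<omega>) / 64"
proof -
  define f :: "int \<Rightarrow> int \<Rightarrow> real" where "f r s = (if odd s then 1/8 else if odd r then 1/4 else if s = 2 then 3/8 else 1/4)" for r s
  define g :: "int \<Rightarrow> int \<Rightarrow> real" where "g r s = (if r = 1 \<and> even s then 1/4 else if s = 2 then 3/8 else 1)" for r s
  obtain j where j: "m = 4 * j + 2" using m by (metis mult_div_mod_eq)
  obtain k where k: "n = 8 * k + 4" using n by (metis mult_div_mod_eq)
  have "real (card F) \<le> real ((2 * j + 1) * (2 * k + 1)) * (\<Sum>r\<in>{0..<2}. \<Sum>s\<in>{0..<4}. f r s) - f 0 0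
    + (if even n then g 0 (int (n div 2) mod 4) else 0)
    + (if even m then g (int (m div 2) mod 2) 0 else 0)
    + (if even m \<and> even n then g (int (m div 2) mod 2) (int (n div 2) mod 4) else 0) + 1/2 * \<omega>"
    by (rule class_card_bound[OF mn code la \<omega>]; (simp only: residues)?; (auto simp: f_def g_def j k)?)
  then show ?thesis  by (simp add: residues f_def g_def j k algebra_simps)
qed

text \<open>A weight modulo 2 has the larger mean 5/24, but the smaller constant 1/3 instead of 5/8
  and shortfall 1/3 instead of 1/2 per subgroup of order 3. This pays off in small groups with such
  subgroups.\<close>

lemma class_card_bound_2_4_small:
  assumes mn: "0 < m" "0 < n" and code: "OOSPC m n 3 la 1 F" and la: "la \<in> {2, 3}"
    and \<omega>: "\<omega> = (if la = 2 then 0 else xi m n)" and m: "m mod 4 = 2" and n: "n mod 8 = 4"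
  shows "real (card F) \<le> (5 * real (m * n) + 8 + 8 * real \<omega>) / 24"
proof -
  define f :: "int \<Rightarrow> int \<Rightarrow> real" where "f r s = (if odd r \<or> odd s then 1/6 else 1/3)" for r s
  define g :: "int \<Rightarrow> int \<Rightarrow> real" where "g r s = (if r = 1 \<and> even s then 1/6 else if s = 2 then 1/3 else 1)" for r s
  obtain j where j: "m = 4 * j + 2" using m by (metis mult_div_mod_eq)
  obtain k where k: "n = 8 * k + 4" using n by (metis mult_div_mod_eq)
  have "real (card F) \<le> real ((2 * j + 1) * (2 * k + 1)) * (\<Sum>r\<in>{0..<2}. \<Sum>s\<in>{0..<4}. f r s) - f 0 0
    + (if even n then g 0 (int (n div 2) mod 4) else 0)
    + (if even m then g (int (m div 2) mod 2) 0 else 0)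
    + (if even m \<and> even n then g (int (m div 2) mod 2) (int (n div 2) mod 4) else 0) + 1/3 * \<omega>"
    by (rule class_card_bound[OF mn code la \<omega>]; (simp only: residues)?; (auto simp: f_def g_def j k)?)
  then show ?thesis  by (simp add: residues f_def g_def j k algebra_simps)
qed

text \<open>The involutions lie in the classes (0, 0), (1, 0), (1, 0) with surplus 1/4 each, so the
  constant is \<open>3/4 - 1/4 = 32/64\<close>.\<close>

lemma class_card_bound_2_8:
  assumes mn: "0 < m" "0 < n" and code: "OOSPC m n 3 la 1 F" and la: "la \<in> {2, 3}"
    and \<omega>: "\<omega> = (if la = 2 then 0 else xi m n)" and m: "m mod 4 = 2" and n: "n mod 8 = 0"
  shows "real (card F) \<le> (13 * real (m * n) + 32 + 32 * real \<omega>) / 64"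
proof -
  define f :: "int \<Rightarrow> int \<Rightarrow> real" where "f r s = (if odd s then 1/8 else if odd r then 1/4 else if s = 2 then 3/8 else 1/4)" for r s
  define g :: "int \<Rightarrow> int \<Rightarrow> real" where "g r s = (if even s \<and> (s = 0 \<or> r = 1) then 1/4 else 1)" for r s
  obtain j where j: "m = 4 * j + 2" using m by (metis mult_div_mod_eq)
  obtain k where k: "n = 8 * k" using n by auto
  have "real (card F) \<le> real ((2 * j + 1) * (2 * k)) * (\<Sum>r\<in>{0..<2}. \<Sum>s\<in>{0..<4}. f r s) - f 0 0
    + (if even n then g 0 (int (n div 2) mod 4) else 0)
    + (if even m then g (int (m div 2) mod 2) 0 else 0)
    + (if even m \<and> even n then g (int (m div 2) mod 2) (int (n div 2) mod 4) else 0) + 1/2 * \<omega>"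
    by (rule class_card_bound[OF mn code la \<omega>]; (simp only: residues)?; (auto simp: f_def g_def j k)?)
  then show ?thesis  by (simp add: residues f_def g_def j k algebra_simps)
qed

text \<open>Each involution is twice an odd-class element of order 4, so it needs total weight 2/3:
  \<open>2/6 + 2/3 = 1\<close>. The constant is \<open>3 * 1/3 - 1/4 = 48/64\<close>.\<close>

lemma class_card_bound_4_4:
  assumes mn: "0 < m" "0 < n" and code: "OOSPC m n 3 la 1 F" and la: "la \<in> {2, 3}"
    and \<omega>: "\<omega> = (if la = 2 then 0 else xi m n)" and m: "m mod 8 = 4" and n: "n mod 8 = 4"
  shows "real (card F) \<le> (13 * real (m * n) + 48 + 32 * real \<omega>) / 64"
proof -
  define f :: "int \<Rightarrow> int \<Rightarrow> real" where "f r s = (if odd r \<or> odd s then 1/6 else if r = 2 \<or> s = 2 then 1/3 else 1/4)" for r s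
  define g :: "int \<Rightarrow> int \<Rightarrow> real" where "g r s = (if even r \<and> even s \<and> (r = 2 \<or> s = 2) then 1/3 else 1)" for r s
  obtain j where j: "m = 8 * j + 4" using m by (metis mult_div_mod_eq)
  obtain k where k: "n = 8 * k + 4" using n by (metis mult_div_mod_eq)
  have "real (card F) \<le> real ((2 * j + 1) * (2 * k + 1)) * (\<Sum>r\<in>{0..<4}. \<Sum>s\<in>{0..<4}. f r s) - f 0 0
    + (if even n then g 0 (int (n div 2) mod 4) else 0)
    + (if even m then g (int (m div 2) mod 4) 0 else 0)
    + (if even m \<and> even n then g (int (m div 2) mod 4) (int (n div 2) mod 4) else 0) + 1/2 * \<omega>"
    by (rule class_card_bound[OF mn code la \<omega>]; (simp only: residues)?; (auto simp: f_def g_def j k)?)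
  then show ?thesis  by (simp add: residues f_def g_def j k algebra_simps)
qed

text \<open>The two involutions in class (2, 0) are again doubles from odd classes and need surplus
  1/3. The third lies in class (0, 0), where \<open>w3\<close> for \<open>a\<close> in that class
  reads \<open>2/4 + 1/2 = 1\<close>. The constant is
  \<open>1/4 + 2/3 - 1/4 = 128/192\<close>.\<close>

lemma class_card_bound_4_8:
  assumes mn: "0 < m" "0 < n" and code: "OOSPC m n 3 la 1 F" and la: "la \<in> {2, 3}"
    and \<omega>: "\<omega> = (if la = 2 then 0 else xi m n)" and m: "m mod 8 = 4" and n: "n mod 8 = 0"
  shows "real (card F) \<le> (39 * real (m * n) + 128 + 96 * real \<omega>) / 192"
proof -
  define f :: "int \<Rightarrow> int \<Rightarrow> real" where "f r s = (if odd r \<or> odd s then 1/6 else if r = 2 \<or> s = 2 then 1/3 else 1/4)" for r s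
  define g :: "int \<Rightarrow> int \<Rightarrow> real" where "g r s = (if r = 0 \<and> s = 0 then 1/4 else if r = 2 \<and> s = 0 then 1/3 else 1)" for r s
  obtain j where j: "m = 8 * j + 4" using m by (metis mult_div_mod_eq)
  obtain k where k: "n = 8 * k" using n by auto
  have "real (card F) \<le> real ((2 * j + 1) * (2 * k)) * (\<Sum>r\<in>{0..<4}. \<Sum>s\<in>{0..<4}. f r s) - f 0 0
    + (if even n then g 0 (int (n div 2) mod 4) else 0)
    + (if even m then g (int (m div 2) mod 4) 0 else 0)
    + (if even m \<and> even n then g (int (m div 2) mod 4) (int (n div 2) mod 4) else 0) + 1/2 * \<omega>"
    by (rule class_card_bound[OF mn code la \<omega>]; (simp only: residues)?; (auto simp: f_def g_def j k)?)
  then show ?thesis  by (simp add: residues f_def g_def j k algebra_simps)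
qed

text \<open>All three involutions lie in class (0, 0) with surplus 1/4, so the constant is
  \<open>3/4 - 1/4 = 32/64\<close>.\<close>

lemma class_card_bound_8_8:
  assumes mn: "0 < m" "0 < n" and code: "OOSPC m n 3 la 1 F" and la: "la \<in> {2, 3}"
    and \<omega>: "\<omega> = (if la = 2 then 0 else xi m n)" and m: "m mod 8 = 0" and n: "n mod 8 = 0"
  shows "real (card F) \<le> (13 * real (m * n) + 32 + 32 * real \<omega>) / 64"
proof -
  define f :: "int \<Rightarrow> int \<Rightarrow> real" where "f r s = (if odd r \<or> odd s then 1/6 else if r = 2 \<or> s = 2 then 1/3 else 1/4)" for r s
  define g :: "int \<Rightarrow> int \<Rightarrow> real" where "g r s = (if r = 0 \<and> s = 0 then 1/4 else 1)" for r s
  obtain j where j: "m = 8 * j" using m by auto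
  obtain k where k: "n = 8 * k" using n by auto
  have "real (card F) \<le> real ((2 * j) * (2 * k)) * (\<Sum>r\<in>{0..<4}. \<Sum>s\<in>{0..<4}. f r s) - f 0 0
    + (if even n then g 0 (int (n div 2) mod 4) else 0)
    + (if even m then g (int (m div 2) mod 4) 0 else 0)
    + (if even m \<and> even n then g (int (m div 2) mod 4) (int (n div 2) mod 4) else 0) + 1/2 * \<omega>"
    by (rule class_card_bound[OF mn code la \<omega>]; (simp only: residues)?; (auto simp: f_def g_def j k)?)
  then show ?thesis  by (simp add: residues f_def g_def j k algebra_simps)
qed

section \<open>Perturbed and sporadic weights\<close>

text \<open>Classes are single elements, and \<open>f 0 0 = 1\<close> is free because 0 is left out.
  The nonzero elements weigh \<open>6/5 + 3/5 = 9/5\<close>. The short sets are tight: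
  \<open>2/5 + 3/5\<close> for an element of order 4 and its double, \<open>1/5 + 1/5 + 3/5\<close>
  for the Klein four-group.\<close>

lemma card_OOSPC_2_4:
  assumes code: "OOSPC 2 4 3 la 1 F" and la: "la \<in> {2, 3}"
  shows "card F \<le> 1"
proof -
  define f :: "int \<Rightarrow> int \<Rightarrow> real" where
    "f r s = (if odd r \<or> odd s then 1/5 else if s = 2 then 3/5 else 1)" for r s
  define g :: "int \<Rightarrow> int \<Rightarrow> real" where "g r s = (if odd s then 1 else 0)" for r s
  have "real (card F) \<le> real (1 * 1) * (\<Sum>r\<in>{0..<2}. \<Sum>s\<in>{0..<4}. f r s) - f 0 0
    + (if even (4::nat) then g 0 (int (4 div 2) mod 4) else 0)
    + (if even (2::nat) then g (int (2 div 2) mod 2) 0 else 0)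
    + (if even (2::nat) \<and> even (4::nat) then g (int (2 div 2) mod 2) (int (4 div 2) mod 4) else 0)
    + 0 * real (if la = 2 then 0 else xi 2 4)"
    by (rule class_card_bound[OF _ _ code la refl]; (simp only: residues)?; (auto simp: f_def g_def)?)
  also have "\<dots> < 2" by (simp add: residues f_def g_def)
  finally show ?thesis by simp
qed

text \<open>One of \<open>a\<close>, \<open>b\<close>, \<open>a + b\<close> has even second
  coordinate, so weight 1/2 on those elements covers every pair, and surplus 1/2 covers the
  involution. Triads also reach weight 1, so \<open>e = 0\<close> and subgroups of order 3 cost
  nothing.\<close>

lemma card_OOSPC_3_12:
  assumes code: "OOSPC 3 12 3 la 1 F" and la: "la \<in> {2, 3}"
  shows "card F \<le> 9"
proof -
  define f :: "int \<Rightarrow> int \<Rightarrow> real" where "f r s = (if odd s then 0 else 1/2)" for r s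
  define g :: "int \<Rightarrow> int \<Rightarrow> real" where "g r s = (if s = 2 then 1/2 else 1)" for r s
  have "real (card F) \<le> real (3 * 3) * (\<Sum>r\<in>{0..<1}. \<Sum>s\<in>{0..<4}. f r s) - f 0 0
    + (if even (12::nat) then g 0 (int (12 div 2) mod 4) else 0)
    + (if even (3::nat) then g (int (3 div 2) mod 1) 0 else 0)
    + (if even (3::nat) \<and> even (12::nat) then g (int (3 div 2) mod 1) (int (12 div 2) mod 4) else 0)
    + 0 * real (if la = 2 then 0 else xi 3 12)"
    by (rule class_card_bound[OF _ _ code la refl]; (simp only: residues)?; (auto simp: f_def g_def)?)
  also have "\<dots> \<le> 9" by (simp add: residues f_def g_def)
  finally show ?thesis by simp
qed

text \<open>A lower bound is enough: it turns \<open>card F \<le> 9\<close> into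
  \<open>7 + 4/2\<close> for \<open>la = 3\<close>.\<close>

lemma xi_3_12: "4 \<le> xi 3 12"
proof -
  let ?A = "{{0, (1, 0), (2, 0)}, {0, (0, 4), (0, 8)}, {0, (1, 4), (2, 8)}, {0, (1, 8), (2, 4)}} :: (int \<times> int) set set"
  have "?A \<subseteq> {H. subgroup H (Zmn 3 12) \<and> card H = 3}"
    using order_3_subgroup[of 3 12 "(1, 0)"] order_3_subgroup[of 3 12 "(0, 4)"]
      order_3_subgroup[of 3 12 "(1, 4)"] order_3_subgroup[of 3 12 "(1, 8)"]
    by (simp add: red_mod_def zero_prod_def)
  then have "card ?A \<le> xi 3 12"
    unfolding xi_def by (intro card_mono finite_subgroups_Zmn) simp_all
  moreover have "card ?A = 4"
    by (simp add: zero_prod_def insert_eq_iff doubleton_eq_iff)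
  ultimately show ?thesis by linarith
qed

text \<open>For \<open>\<lambda>\<^sub>a = 2\<close> the elements of order 3 may get less weight than the other elements of \<open>4G\<close>, since
  they never serve as \<open>a\<close> in a difference set \<open>{\<plusminus>a, \<plusminus>2a}\<close>.\<close>

lemma class_card_bound_order_3:
  fixes f g :: "int \<Rightarrow> int \<Rightarrow> real" and p q :: int
  assumes mn: "0 < m" "0 < n" and code: "OOSPC m n 3 2 1 F"
    and p: "0 < p" "\<not> 3 dvd p" "int m = p * int m'"
    and q: "0 < q" "\<not> 3 dvd q" "int n = q * int n'"
    and zero: "\<And>a. \<lbrakk>p dvd fst a; q dvd snd a; red_mod m n ((a + a) + (a + a) + (a + a)) = 0\<rbrakk>
      \<Longrightarrow> red_mod m n (a + a + a) = 0"
    and S: "S \<subseteq> {0..<int m} \<times> {0..<int n} - {0}" "\<And>a. a \<in> S \<Longrightarrow> red_mod m n (a + a + a) = 0"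
    and c: "0 \<le> c" "c \<le> b" "1 / 4 \<le> b"
    and nonneg: "\<And>r s. 0 \<le> f r s" "\<And>r s. 0 \<le> g r s" and f00: "f 0 0 = c"
    and even: "\<And>r s. r \<in> {0..<p} \<Longrightarrow> s \<in> {0..<q} \<Longrightarrow> f (- r mod p) (- s mod q) = f r s"
      "\<And>r s. r \<in> {0..<p} \<Longrightarrow> s \<in> {0..<q} \<Longrightarrow> g (- r mod p) (- s mod q) = g r s"
    and w6: "\<And>r s t u. r \<in> {0..<p} \<Longrightarrow> s \<in> {0..<q} \<Longrightarrow> t \<in> {0..<p} \<Longrightarrow> u \<in> {0..<q} \<Longrightarrow>
      1 / 2 \<le> f r s + f t u + f ((r + t) mod p) ((s + u) mod q)"
    and w4: "\<And>r s. r \<in> {0..<p} \<Longrightarrow> s \<in> {0..<q} \<Longrightarrow> (r, s) \<noteq> (0, 0) \<Longrightarrow>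
      1 / 2 \<le> f r s + f ((r + r) mod p) ((s + s) mod q)"
    and w3: "\<And>r s. r \<in> {0..<p} \<Longrightarrow> s \<in> {0..<q} \<Longrightarrow>
      1 \<le> 2 * f r s + f ((r + r) mod p) ((s + s) mod q) + g ((r + r) mod p) ((s + s) mod q)"
    and wK: "\<And>r s t u. r \<in> {0..<p} \<Longrightarrow> s \<in> {0..<q} \<Longrightarrow> t \<in> {0..<p} \<Longrightarrow> u \<in> {0..<q} \<Longrightarrow>
      1 \<le> f r s + f t u + f ((r + t) mod p) ((s + u) mod q) + g r s + g t u
         + g ((r + t) mod p) ((s + u) mod q)"
    and w5: "\<And>r s t u. r \<in> {0..<p} \<Longrightarrow> s \<in> {0..<q} \<Longrightarrow> t \<in> {0..<p} \<Longrightarrow> u \<in> {0..<q} \<Longrightarrow>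
      1 \<le> f r s + g r s + 2 * f t u + 2 * f ((r + t) mod p) ((s + u) mod q)"
  shows "real (card F) \<le> real (m' * n') * ((\<Sum>r\<in>{0..<p}. \<Sum>s\<in>{0..<q}. f r s) + (b - c)) - b
    - (b - c) * card S
    + (if even n then g 0 (int (n div 2) mod q) else 0)
    + (if even m then g (int (m div 2) mod p) 0 else 0)
    + (if even m \<and> even n then g (int (m div 2) mod p) (int (n div 2) mod q) else 0)"
proof -
  define F2 where "F2 r s = (if r = 0 \<and> s = 0 then b else f r s)" for r s :: int
  \<comment> \<open>The weight is \<open>c\<close> on 0 and the elements of order 3, and
    \<open>b\<close> on the rest of the class (0, 0).\<close>
  define h where "h a = (if red_mod m n (a + a + a) = 0 then c else on_class p q F2 a)" for a
  have range: "x mod p \<in> {0..<p}" "x mod q \<in> {0..<q}" for x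
    using p q by simp_all
  have class_0: "fst a mod p = 0 \<and> snd a mod q = 0" if "red_mod m n (a + a + a) = 0" for a
  proof -
    have "p dvd 3 * fst a" "q dvd 3 * snd a"
      using that dvd_mult_left by (auto simp: red_mod_eq_0_iff p(3) q(3))
    then show ?thesis
      using p(2) q(2) by (auto intro!: dvd_imp_mod_0 intro: dvd_triple_imp_dvd)
  qed
  have F2: "f r s \<le> F2 r s" for r s using c f00 by (simp add: F2_def)
  have le: "on_class p q f a \<le> h a" for a
    using class_0[of a] F2 by (simp add: h_def on_class_def f00)
  have tr: "red_mod m n (red_mod m n a + red_mod m n a + red_mod m n a) = red_mod m n (a + a + a)" for a
    by (simp add: red_mod_def mod_simps)
  have tru: "red_mod m n (- a + - a + - a) = 0 \<longleftrightarrow> red_mod m n (a + a + a) = 0" for a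
  proof -
    have "- a + - a + - a = - (a + a + a)" by simp
    then show ?thesis by (simp only: red_mod_eq_0_iff fst_uminus snd_uminus dvd_minus_iff)
  qed
  have F2even: "F2 (- r mod p) (- s mod q) = F2 r s" if "r \<in> {0..<p}" "s \<in> {0..<q}" for r s
  proof -
    have "- r mod p = 0 \<longleftrightarrow> r = 0" "- s mod q = 0 \<longleftrightarrow> s = 0"
      using that by (simp_all add: zmod_zminus1_eq_if)
    then show ?thesis using even(1)[OF that] by (simp add: F2_def)
  qed
  let ?B = "{0..<int m} \<times> {0..<int n}"
  have "real (card F) \<le> sum h ?B - h 0
    + (if even n then on_class p q g (0, int (n div 2)) else 0)
    + (if even m then on_class p q g (int (m div 2), 0) else 0)
    + (if even m \<and> even n then on_class p q g (int (m div 2), int (n div 2)) else 0) + 1 * real 0"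
  \<comment> \<open>Since \<open>la = 2\<close> admits no triads, the shortfall can be set to
    \<open>e = 1\<close> and is multiplied by 0.\<close>
  proof (rule OOSPC_card_bound[OF mn code])
    fix a b' :: "int \<times> int"
    show "0 \<le> h a" using c nonneg by (simp add: h_def on_class_def F2_def)
    show "h (red_mod m n a) = h a"
      by (simp only: h_def tr on_class_red_mod[OF p(3) q(3)])
    show "h (- a) = h a"
      by (simp only: h_def tru on_class_uminus F2even[OF range]) (simp add: on_class_def)
    show "1 / 2 \<le> h a + h b' + h (a + b')"
      using w6[OF range range, of "fst a" "snd a" "fst b'" "snd b'"] le[of a] le[of b'] le[of "a + b'"]
      unfolding on_class_add by (simp add: on_class_def)
    show "1 \<le> h a + h b' + h (a + b') + on_class p q g a + on_class p q g b' + on_class p q g (a + b')"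
      using wK[OF range range, of "fst a" "snd a" "fst b'" "snd b'"] le[of a] le[of b'] le[of "a + b'"]
      unfolding on_class_add by (simp add: on_class_def)
    show "1 \<le> 2 * h a + h (a + a) + on_class p q g (a + a)"
      using w3[OF range, of "fst a" "snd a"] le[of a] le[of "a + a"]
      unfolding on_class_add by (simp add: on_class_def)
    show "1 \<le> h a + on_class p q g a + 2 * h b' + 2 * h (a + b')"
      using w5[OF range range, of "fst a" "snd a" "fst b'" "snd b'"] le[of a] le[of b'] le[of "a + b'"]
      unfolding on_class_add by (simp add: on_class_def)
    show "0 \<le> on_class p q g a" using nonneg by (simp add: on_class_def)
    show "on_class p q g (red_mod m n a) = on_class p q g a"
      by (rule on_class_red_mod[OF p(3) q(3)])
    show "on_class p q g (- a) = on_class p q g a"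
      by (simp only: on_class_uminus even(2)[OF range]) (simp add: on_class_def)
    show "1 - 1 \<le> 2 * h a" using c nonneg by (simp add: h_def on_class_def F2_def)
    assume n3: "red_mod m n (a + a + a) \<noteq> 0"
    show "1 / 2 \<le> h a + h (a + a)"
    proof (cases "fst a mod p = 0 \<and> snd a mod q = 0")
      case True
      \<comment> \<open>By \<open>zero\<close>, doubling inside the class (0, 0) never produces an
        element of order 3 from another one, so both terms are \<open>b \<ge> 1/4\<close>.\<close>
      then have "red_mod m n ((a + a) + (a + a) + (a + a)) \<noteq> 0"
        using zero[of a] n3 by auto
      then have "h a = b" "h (a + a) = b"
        using True n3 unfolding h_def on_class_add by (simp_all add: on_class_def F2_def)
      with c show ?thesis by simp
    next
      case False
      then show ?thesis
        using w4[OF range, of "fst a" "snd a"] le[of a] le[of "a + a"]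
        unfolding on_class_add by (auto simp: on_class_def)
    qed
  qed simp_all
  \<comment> \<open>The \<open>+ 1\<close> accounts for the element 0, which also gets
    \<open>c\<close>.\<close>
  moreover have "sum h ?B \<le> sum (on_class p q F2) ?B - (b - c) * (card S + 1)"
  proof -
    let ?T = "{a \<in> ?B. red_mod m n (a + a + a) = 0}"
    have "h a = on_class p q F2 a - (if red_mod m n (a + a + a) = 0 then b - c else 0)" for a
      using class_0[of a] by (simp add: h_def on_class_def F2_def)
    then have "sum h ?B = sum (on_class p q F2) ?B - (\<Sum>a\<in>?B. if red_mod m n (a + a + a) = 0 then b - c else 0)"
      by (simp add: sum_subtractf)
    also have "(\<Sum>a\<in>?B. if red_mod m n (a + a + a) = 0 then b - c else 0) = (b - c) * card ?T"
      by (subst sum.inter_filter[symmetric]) simp_all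
    finally have "sum h ?B = sum (on_class p q F2) ?B - (b - c) * card ?T" .
    moreover have "card (insert 0 S) \<le> card ?T"
      using S mn by (intro card_mono) (auto simp: red_mod_def zero_prod_def)
    moreover have "card (insert 0 S) = card S + 1"
      using S finite_subset[OF S(1)] by (subst card_insert_disjoint) auto
    ultimately show ?thesis using c(2) mult_left_mono[of "real (card S + 1)" "real (card ?T)" "b - c"] by simp
  qed
  moreover have "sum (on_class p q F2) ?B
      = real (m' * n') * (\<Sum>r\<in>{0..<p}. \<Sum>s\<in>{0..<q}. F2 r s)"
    using sum_mod_box[OF p(1) q(1) p(3) q(3), of F2] by (simp add: on_class_def)
  moreover have "(\<Sum>r\<in>{0..<p}. \<Sum>s\<in>{0..<q}. F2 r s) = (\<Sum>r\<in>{0..<p}. \<Sum>s\<in>{0..<q}. f r s) + (b - c)"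
  proof -
    have "F2 r s = f r s + (if s = 0 then if r = 0 then b - c else 0 else 0)" for r s
      by (simp add: F2_def f00)
    then show ?thesis using p(1) q(1) by (simp add: sum.distrib sum.delta)
  qed
  moreover have "h 0 = c" "on_class p q g (x, y) = g (x mod p) (y mod q)" for x y
    by (simp_all add: h_def on_class_def red_mod_eq_0_iff)
  ultimately show ?thesis by (cases "even m"; cases "even n") (simp_all add: algebra_simps)
qed

text \<open>The class of 0 consists of 0 and the eight elements of \<open>S\<close>, all of order 3,
  so the value 1/4 for \<open>b\<close> cancels out. The total is
  \<open>18/6 + 9/3 + 1/3 + 8/6 = 23/3\<close>.\<close>

lemma card_OOSPC_3_12_la_2:
  assumes code: "OOSPC 3 12 3 2 1 F"
  shows "card F \<le> 7"
proof -
  define f :: "int \<Rightarrow> int \<Rightarrow> real" where "f r s = (if s = 2 then 1/3 else 1/6)" for r s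
  define g :: "int \<Rightarrow> int \<Rightarrow> real" where "g r s = (if s = 2 then 1/3 else 1)" for r s
  define S :: "(int \<times> int) set" where "S = {(0, 4), (0, 8), (1, 0), (1, 4), (1, 8), (2, 0), (2, 4), (2, 8)}"
  have "real (card F) \<le> real (3 * 3) * ((\<Sum>r\<in>{0..<1}. \<Sum>s\<in>{0..<4}. f r s) + (1/4 - 1/6)) - 1/4
    - (1/4 - 1/6) * card S
    + (if even (12::nat) then g 0 (int (12 div 2) mod 4) else 0)
    + (if even (3::nat) then g (int (3 div 2) mod 1) 0 else 0)
    + (if even (3::nat) \<and> even (12::nat) then g (int (3 div 2) mod 1) (int (12 div 2) mod 4) else 0)"
  proof (rule class_card_bound_order_3[OF _ _ code])
    fix a :: "int \<times> int"
    assume "4 dvd snd a"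
    then show "red_mod 3 12 (a + a + a) = 0" by (auto simp: red_mod_eq_0_iff)
  qed ((simp only: residues)?; (auto simp: f_def g_def S_def red_mod_def zero_prod_def)?)+
  also have "\<dots> < 8" by (simp add: residues f_def g_def S_def)
  finally show ?thesis by simp
qed

lemma odd_dvd_double: "2 * int i + 1 dvd 2 * x \<Longrightarrow> 2 * int i + 1 dvd x"
  using coprime_dvd_mult_right_iff[of "2 * int i + 1" 2 x] by simp

text \<open>Lowering one element of order 3 from 1/4 to 1/6 saves 1/12 over
  \<open>class_card_bound_4_4\<close>, which gives the strict inequality.\<close>

lemma class_card_bound_4_4_la_2:
  assumes mn: "0 < m" "0 < n" and code: "OOSPC m n 3 2 1 F"
    and m: "m mod 8 = 4" and n: "n mod 8 = 4" and 3: "3 dvd m * n"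
  shows "real (card F) < (13 * real (m * n) + 48) / 64"
proof -
  define f :: "int \<Rightarrow> int \<Rightarrow> real" where
    "f r s = (if even r \<and> even s \<and> (r = 2 \<or> s = 2) then 1/3 else 1/6)" for r s
  define g :: "int \<Rightarrow> int \<Rightarrow> real" where
    "g r s = (if even r \<and> even s \<and> (r = 2 \<or> s = 2) then 1/3 else 1)" for r s
  obtain j where j: "m = 8 * j + 4" using m by (metis mult_div_mod_eq)
  obtain k where k: "n = 8 * k + 4" using n by (metis mult_div_mod_eq)
  have "3 dvd m \<or> 3 dvd n" using 3 by (simp add: prime_dvd_mult_iff)
  then obtain d where d: "d \<in> {0..<int m} \<times> {0..<int n} - {0}" "red_mod m n (d + d + d) = 0"
  proof
    assume "3 dvd m"
    then obtain c where "m = 3 * c" by blast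
    with mn show thesis by (intro that[of "(int c, 0)"]) (auto simp: red_mod_def zero_prod_def)
  next
    assume "3 dvd n"
    then obtain c where "n = 3 * c" by blast
    with mn show thesis by (intro that[of "(0, int c)"]) (auto simp: red_mod_def zero_prod_def)
  qed
  \<comment> \<open>The multiples of 4 modulo \<open>8 * i + 4\<close> form a group of odd order
    \<open>2 * i + 1\<close>, so \<open>6 * x = 0\<close> implies \<open>3 * x = 0\<close>
    there.\<close>
  have odd_part: "int (8 * i + 4) dvd x + x + x"
    if x: "4 dvd x" "int (8 * i + 4) dvd x + x + (x + x) + (x + x)" for i :: nat and x :: int
  proof -
    obtain y where y: "x = 4 * y" using x(1) by blast
    have "4 * (2 * int i + 1) dvd 4 * (2 * (3 * y))" using x(2) by (simp add: y algebra_simps)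
    then have "2 * int i + 1 dvd 2 * (3 * y)" by (simp only: dvd_mult_cancel_left) simp
    then have "2 * int i + 1 dvd 3 * y" by (rule odd_dvd_double)
    then have "4 * (2 * int i + 1) dvd 4 * (3 * y)" by (rule mult_dvd_mono[OF dvd_refl])
    then show ?thesis by (simp add: y algebra_simps)
  qed
  have "real (card F) \<le> real ((2 * j + 1) * (2 * k + 1)) * ((\<Sum>r\<in>{0..<4}. \<Sum>s\<in>{0..<4}. f r s) + (1/4 - 1/6)) - 1/4
    - (1/4 - 1/6) * card {d}
    + (if even n then g 0 (int (n div 2) mod 4) else 0)
    + (if even m then g (int (m div 2) mod 4) 0 else 0)
    + (if even m \<and> even n then g (int (m div 2) mod 4) (int (n div 2) mod 4) else 0)"
  proof (rule class_card_bound_order_3[OF mn code])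
    fix a :: "int \<times> int"
    assume "4 dvd fst a" "4 dvd snd a" "red_mod m n ((a + a) + (a + a) + (a + a)) = 0"
    then show "red_mod m n (a + a + a) = 0"
      using odd_part[of "fst a" j] odd_part[of "snd a" k] by (simp add: red_mod_eq_0_iff j k)
  next
    show "{d} \<subseteq> {0..<int m} \<times> {0..<int n} - {0}" "\<And>a. a \<in> {d} \<Longrightarrow> red_mod m n (a + a + a) = 0"
      using d by auto
  qed ((simp only: residues)?; (auto simp: f_def g_def j k)?)+
  then show ?thesis by (simp add: residues f_def g_def j k algebra_simps)
qed

lemma even_mod_4: "even ((x::int) mod 4) \<longleftrightarrow> even x"
  by presburger

text \<open>For \<open>\<int>\<^sub>4 \<times> \<int>\<^sub>8\<close> times a group of odd order, the involution \<open>h = (0, n/2)\<close> lies in \<open>4G\<close> and the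
  other two in the class \<open>(2, 0)\<close>. The perturbation favours the codewords through the latter two at the
  expense of the differences \<open>{h, \<plusminus>b, \<plusminus>(b + h)}\<close> with \<open>b\<close> congruent to \<open>(t, 1)\<close> modulo 2. At most one
  codeword contains \<open>h\<close> as a difference, so the latter do not occur for one of \<open>t = 0, 1\<close>.\<close>

definition weight_4_8 :: "int \<Rightarrow> int \<Rightarrow> int \<Rightarrow> real" where
  "weight_4_8 t r s = (if even s then (if odd r then 1/6 + 1/50 else if r = 2 \<and> s = 0 then 1/3 - 1/50
      else if r = 0 \<and> s = 0 then 1/4 else if r = 2 * t then 1/3 + 1/50 else 1/3)
    else if r mod 2 = t then 1/6 - 1/50 else 1/6)"

text \<open>At (0, 0) the total is \<open>1/4 + 1/12 = 1/3\<close>, just enough for \<open>b\<close>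
  outside the lowered classes: \<open>1/3 + 4/6 = 1\<close>. At (2, 0) the total
  \<open>2/3 - 2/50\<close> is tight against doubling:
  \<open>2 * (1/6 + 1/50) + 2/3 - 2/50 = 1\<close>.\<close>

definition surplus_4_8 :: "int \<Rightarrow> int \<Rightarrow> real" where
  "surplus_4_8 r s = (if r = 0 \<and> s = 0 then 1/12 else if r = 2 \<and> s = 0 then 1/3 - 1/50 else 1)"

section \<open>Verification of the perturbed weight\<close>

lemma weight_4_8_even:
  assumes "r \<in> {0..<4}" and "s \<in> {0..<4}" and "t \<in> {0, 1}"
  shows "weight_4_8 t (- r mod 4) (- s mod 4) = weight_4_8 t r s"
  using assms unfolding residues insert_iff empty_iff
  by (elim disjE FalseE) (simp_all add: weight_4_8_def)

lemma surplus_4_8_even: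
  assumes "r \<in> {0..<4}" and "s \<in> {0..<4}"
  shows "surplus_4_8 (- r mod 4) (- s mod 4) = surplus_4_8 r s"
  using assms unfolding residues insert_iff empty_iff
  by (elim disjE FalseE) (simp_all add: surplus_4_8_def)

text \<open>The classes (1, 0), (t, 1), (1 - t, 1) modulo 2 carry \<open>1/6 + 1/50\<close>,
  \<open>1/6 - 1/50\<close> and 1/6, still 1/2 together; the other triples have slack that a small
  perturbation does not exhaust.\<close>

lemma weight_4_8_generic:
  assumes "r \<in> {0..<4}" and "s \<in> {0..<4}" and "u \<in> {0..<4}" and "v \<in> {0..<4}" and t: "t \<in> {0, 1}"
  shows "1 / 2 \<le> weight_4_8 t r s + weight_4_8 t u v + weight_4_8 t ((r + u) mod 4) ((s + v) mod 4)"
  using assms unfolding residues insert_iff empty_iff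
  by (elim disjE FalseE) (simp_all add: weight_4_8_def)

text \<open>Each change on an odd class is undone at its double: (2, 0) is lowered and (2t, 2) is
  raised by 1/50.\<close>

lemma weight_4_8_double:
  assumes "r \<in> {0..<4}" and "s \<in> {0..<4}" and t: "t \<in> {0, 1}"
  shows "1 / 2 \<le> weight_4_8 t r s + weight_4_8 t ((r + r) mod 4) ((s + s) mod 4)"
  using assms unfolding residues insert_iff empty_iff
  by (elim disjE FalseE) (simp_all add: weight_4_8_def)

text \<open>The excluded classes violate the inequality, but contain no elements of order 4 when
  \<open>m mod 8 = 4\<close> and \<open>n mod 16 = 8\<close>.\<close>

lemma weight_4_8_order_4:
  assumes "r \<in> {0..<4}" and "s \<in> {0..<4}" and "\<not> (even r \<and> s = 0)" and t: "t \<in> {0, 1}"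
  shows "1 \<le> 2 * weight_4_8 t r s + weight_4_8 t ((r + r) mod 4) ((s + s) mod 4) + surplus_4_8 ((r + r) mod 4) ((s + s) mod 4)"
  using assms unfolding residues insert_iff empty_iff
  by (elim disjE FalseE) (simp_all add: weight_4_8_def surplus_4_8_def)

lemma weight_4_8_klein:
  assumes "r \<in> {0..<4}" and "s \<in> {0..<4}" and "u \<in> {0..<4}" and "v \<in> {0..<4}" and t: "t \<in> {0, 1}"
  shows "1 \<le> weight_4_8 t r s + weight_4_8 t u v + weight_4_8 t ((r + u) mod 4) ((s + v) mod 4) + surplus_4_8 r s + surplus_4_8 u v
       + surplus_4_8 ((r + u) mod 4) ((s + v) mod 4)"
  using assms unfolding residues insert_iff empty_iff
  by (elim disjE FalseE) (simp_all add: weight_4_8_def surplus_4_8_def)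

text \<open>In the excluded case the left-over weight is only
  \<open>1/3 + 4 * (1/6 - 1/50) < 1\<close>.\<close>

lemma weight_4_8_involution:
  assumes "r \<in> {0..<4}" and "s \<in> {0..<4}" and "u \<in> {0..<4}" and "v \<in> {0..<4}" and "\<not> (r = 0 \<and> s = 0 \<and> u mod 2 = t \<and> odd v)" and t: "t \<in> {0, 1}"
  shows "1 \<le> weight_4_8 t r s + surplus_4_8 r s + 2 * weight_4_8 t u v + 2 * weight_4_8 t ((r + u) mod 4) ((s + v) mod 4)"
  using assms unfolding residues insert_iff empty_iff
  by (elim disjE FalseE) (simp_all add: weight_4_8_def surplus_4_8_def)

text \<open>For \<open>n mod 16 = 8\<close> the elements of order 4 above (0, n/2) have second
  coordinate 2 modulo 4 and weight at least 1/3, so the surplus there drops from 1/4 to 1/12. This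
  brings the constant of \<open>class_card_bound_4_8\<close> from 2/3 to 1/2; the perturbation saves
  a further 2/50.\<close>

lemma class_card_bound_4_8_la_2:
  assumes mn: "0 < m" "0 < n" and code: "OOSPC m n 3 2 1 F"
    and m: "m mod 8 = 4" and n: "n mod 16 = 8"
  shows "real (card F) < (13 * real (m * n) + 32) / 64"
proof -
  interpret residue_code "red_mod m n" F by (rule residue_code_OOSPC[OF mn code])
  obtain j where j: "m = 8 * j + 4" using m by (metis mult_div_mod_eq)
  obtain k where k: "n = 16 * k + 8" using n by (metis mult_div_mod_eq)
  have m4: "int m = 4 * int (2 * j + 1)" and n4: "int n = 4 * int (4 * k + 2)"
    by (simp_all add: j k)
  define bad where "bad t \<longleftrightarrow> (\<exists>X\<in>F. \<exists>a b. diffs X = pm a \<union> pm b \<union> pm (a + b) \<and>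
      red_mod m n a = (0, int (n div 2)) \<and> fst b mod 2 = t \<and> odd (snd b))" for t
  \<comment> \<open>Parities of both coordinates survive reduction and negation because
    \<open>m\<close> and \<open>n\<close> are even.\<close>
  have parity: "fst c mod 2 = fst d mod 2 \<and> snd c mod 2 = snd d mod 2" if cd: "red_mod m n c \<in> pm d" for c d
  proof -
    have mods: "x mod int m mod 2 = x mod 2" "x mod int n mod 2 = x mod 2" for x
      by (simp_all add: mod_mod_cancel j k)
    have eq: "fst c mod 2 = fst e mod 2 \<and> snd c mod 2 = snd e mod 2" if "red_mod m n c = red_mod m n e" for e
    proof -
      have "fst c mod int m = fst e mod int m" "snd c mod int n = snd e mod int n"
        using that by (simp_all add: red_mod_def)
      then have "fst c mod int m mod 2 = fst e mod int m mod 2" "snd c mod int n mod 2 = snd e mod int n mod 2"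
        by simp_all
      then show ?thesis by (simp only: mods)
    qed
    have neg: "(- x) mod 2 = x mod (2::int)" for x by presburger
    consider "red_mod m n c = red_mod m n d" | "red_mod m n c = red_mod m n (- d)"
      using cd by (auto simp: pm_def)
    then show ?thesis
      by cases (use eq[of d] eq[of "- d"] in \<open>simp_all only: fst_uminus snd_uminus neg\<close>)
  qed
  have "\<exists>t\<in>{0, 1}. \<not> bad t"
  proof (rule ccontr)
    assume "\<not> ?thesis"
    then have "bad 0" "bad 1" by auto
    from \<open>bad 0\<close> obtain X a b where X: "X \<in> F" "diffs X = pm a \<union> pm b \<union> pm (a + b)"
      "red_mod m n a = (0, int (n div 2))" "fst b mod 2 = 0" "odd (snd b)"
      unfolding bad_def by - (elim bexE exE conjE, rule that, assumption+)
    from \<open>bad 1\<close> obtain Y a' b' where Y: "Y \<in> F" "diffs Y = pm a' \<union> pm b' \<union> pm (a' + b')"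
      "red_mod m n a' = (0, int (n div 2))" "fst b' mod 2 = 1" "odd (snd b')"
      unfolding bad_def by - (elim bexE exE conjE, rule that, assumption+)
    have "(0, int (n div 2)) \<in> diffs X" "(0, int (n div 2)) \<in> diffs Y"
      using X Y by (auto simp: pm_def)
    then have "X = Y" using diffs_disjoint X(1) Y(1) by blast
    then have "red_mod m n b' \<in> pm a \<union> pm b \<union> pm (a + b)"
      using X(2) Y(2) by (auto simp: pm_def)
    moreover have "red_mod m n a \<in> pm (0, int (n div 2))"
      using X(3) red_red[of a] by (simp add: pm_def)
    then have "fst a mod 2 = 0" "snd a mod 2 = 0"
      using parity[of a "(0, int (n div 2))"] by (simp_all add: k)
    \<comment> \<open>Both coordinates of \<open>a\<close> are even, so \<open>b'\<close> must have
      the parities of (0, 0) or of \<open>b\<close>; its first and second coordinates are odd, while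
      \<open>fst b\<close> is even.\<close>
    ultimately show False
      using parity[of b' a] parity[of b' b] parity[of b' "a + b"] X Y
      by (auto simp: mod_add_eq[symmetric, of "fst a"] mod_add_eq[symmetric, of "snd a"] odd_iff_mod_2_eq_one)
  qed
  then obtain t where t: "t \<in> {0, 1}" "\<not> bad t" by blast
  let ?f = "weight_4_8 t" and ?g = surplus_4_8
  have range: "x mod 4 \<in> {0..<4}" for x :: int by simp
  have "real (card F) \<le> sum (on_class 4 4 ?f) ({0..<int m} \<times> {0..<int n}) - on_class 4 4 ?f 0
    + (if even n then on_class 4 4 ?g (0, int (n div 2)) else 0)
    + (if even m then on_class 4 4 ?g (int (m div 2), 0) else 0)
    + (if even m \<and> even n then on_class 4 4 ?g (int (m div 2), int (n div 2)) else 0) + 1 * real 0"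
  proof (rule OOSPC_card_bound[OF mn code])
    fix a b :: "int \<times> int"
    assume a: "red_mod m n (a + a) \<noteq> 0" "red_mod m n ((a + a) + (a + a)) = 0"
    \<comment> \<open>Otherwise, after dividing out the powers of 2, \<open>4 * a = 0\<close> holds
      modulo odd numbers only, and then already \<open>2 * a = 0\<close>.\<close>
    have "\<not> (even (fst a mod 4) \<and> snd a mod 4 = 0)"
    proof
      assume h: "even (fst a mod 4) \<and> snd a mod 4 = 0"
      then obtain x y where xy: "fst a = 2 * x" "snd a = 4 * y"
        by (metis dvd_def mod_0_imp_dvd even_mod_4)
      have "4 * (2 * int j + 1) dvd 4 * (2 * x)" "8 * (2 * int k + 1) dvd 8 * (2 * y)"
        using a(2) by (simp_all add: red_mod_eq_0_iff xy j k algebra_simps)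
      then have "2 * int j + 1 dvd 2 * x" "2 * int k + 1 dvd 2 * y"
        by (simp_all only: dvd_mult_cancel_left) simp_all
      then have "4 * (2 * int j + 1) dvd 4 * x" "8 * (2 * int k + 1) dvd 8 * y"
        using mult_dvd_mono[OF dvd_refl odd_dvd_double] by blast+
      then have "int m dvd fst a + fst a" "int n dvd snd a + snd a"
        by (simp_all add: xy j k algebra_simps)
      then show False using a(1) by (simp add: red_mod_eq_0_iff)
    qed
    from weight_4_8_order_4[OF range range this t(1)]
    show "1 \<le> 2 * on_class 4 4 ?f a + on_class 4 4 ?f (a + a) + on_class 4 4 ?g (a + a)"
      unfolding on_class_add by (simp add: on_class_def)
  next
    fix X a b
    assume X: "X \<in> F" "diffs X = pm a \<union> pm b \<union> pm (a + b)"
      and a: "red_mod m n a \<noteq> 0" "red_mod m n (a + a) = 0"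
    \<comment> \<open>The only involution in the class (0, 0) is (0, n/2), so \<open>X\<close> would
      witness \<open>bad t\<close>.\<close>
    have "\<not> (fst a mod 4 = 0 \<and> snd a mod 4 = 0 \<and> fst b mod 4 mod 2 = t \<and> odd (snd b mod 4))"
    proof
      assume h: "fst a mod 4 = 0 \<and> snd a mod 4 = 0 \<and> fst b mod 4 mod 2 = t \<and> odd (snd b mod 4)"
      then obtain x where x: "fst a = 4 * x" by (metis dvd_def mod_0_imp_dvd)
      have "4 * (2 * int j + 1) dvd 4 * (2 * x)"
        using a(2) by (simp add: red_mod_eq_0_iff x j algebra_simps)
      then have "2 * int j + 1 dvd 2 * x" by (simp only: dvd_mult_cancel_left) simp
      then have "4 * (2 * int j + 1) dvd 4 * x" by (rule mult_dvd_mono[OF dvd_refl odd_dvd_double])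
      then have m0: "int m dvd fst a" by (simp add: x j algebra_simps)
      obtain c where "snd a + snd a = int n * c"
        using a(2) by (auto simp: red_mod_eq_0_iff elim: dvdE)
      then have c: "snd a = (8 * int k + 4) * c" by (simp add: k algebra_simps)
      have "odd c"
      proof
        assume "even c"
        then obtain i where "c = 2 * i" by (rule evenE)
        then have "snd a = int n * i" by (simp add: c k algebra_simps)
        then have "int n dvd snd a" by simp
        with m0 a(1) show False by (simp add: red_mod_eq_0_iff)
      qed
      then obtain i where "c = 2 * i + 1" by (rule oddE)
      then have "snd a = (8 * int k + 4) + int n * i" by (simp add: c k algebra_simps)
      then have "snd a mod int n = (8 * int k + 4) mod int n" by (simp only: mod_mult_self2)
      also have "\<dots> = int (n div 2)" by (simp add: k)
      finally have "red_mod m n a = (0, int (n div 2))" using m0 by (simp add: red_mod_def)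
      moreover have "fst b mod 2 = t"
        using h by (simp add: mod_mod_cancel)
      moreover have "odd (snd b)" using h by (simp add: even_mod_4)
      ultimately have "bad t"
        unfolding bad_def using X by (intro bexI[OF _ X(1)] exI conjI)
      with t(2) show False by contradiction
    qed
    from weight_4_8_involution[OF range range range range this t(1)]
    show "1 \<le> on_class 4 4 ?f a + on_class 4 4 ?g a + 2 * on_class 4 4 ?f b + 2 * on_class 4 4 ?f (a + b)"
      unfolding on_class_add by (simp add: on_class_def)
  qed (use weight_4_8_even[OF range range t(1)] surplus_4_8_even[OF range range] weight_4_8_generic[OF range range range range t(1)]
      weight_4_8_double[OF range range t(1)] weight_4_8_klein[OF range range range range t(1)] in
      \<open>simp_all only: on_class_red_mod[OF m4 n4] on_class_add on_class_uminus\<close>,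
      auto simp: on_class_def weight_4_8_def surplus_4_8_def)
  moreover have "sum (on_class 4 4 ?f) ({0..<int m} \<times> {0..<int n})
      = real ((2 * j + 1) * (4 * k + 2)) * (\<Sum>r\<in>{0..<4}. \<Sum>s\<in>{0..<4}. ?f r s)"
    using sum_mod_box[OF _ _ m4 n4, of ?f] by (simp add: on_class_def)
  \<comment> \<open>The perturbation cancels: four classes up and four down by 1/50 among the odd
    ones, one up and one down among the even ones. The gain lies only in the surplus of the two
    involutions in class (2, 0).\<close>
  moreover have "(\<Sum>r\<in>{0..<4}. \<Sum>s\<in>{0..<4}. ?f r s) = 13/4"
    using t(1) by (auto simp: weight_4_8_def residues)
  moreover have "on_class 4 4 ?f 0 = 1/4" "on_class 4 4 ?g (0, int (n div 2)) = 1/12"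
    "on_class 4 4 ?g (int (m div 2), 0) = 1/3 - 1/50"
    "on_class 4 4 ?g (int (m div 2), int (n div 2)) = 1/3 - 1/50"
    by (simp_all add: on_class_def weight_4_8_def surplus_4_8_def j k)
  ultimately show ?thesis by (simp add: j k algebra_simps)
qed

section \<open>Assembling the cases\<close>

lemma dvd_mult_two_adic:
  fixes m n :: nat
  shows "odd m \<Longrightarrow> 2 ^ k dvd m * n \<longleftrightarrow> 2 ^ k dvd n"
    and "m mod 4 = 2 \<Longrightarrow> 2 ^ Suc k dvd m * n \<longleftrightarrow> 2 ^ k dvd n"
    and "m mod 8 = 4 \<Longrightarrow> 2 ^ Suc (Suc k) dvd m * n \<longleftrightarrow> 2 ^ k dvd n"
proof -
  show *: "2 ^ k dvd m * n \<longleftrightarrow> 2 ^ k dvd n" if "odd m" for k and m n :: nat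
    using that by (simp add: coprime_dvd_mult_right_iff)
  show "2 ^ Suc k dvd m * n \<longleftrightarrow> 2 ^ k dvd n" if "m mod 4 = 2"
  proof -
    have u: "odd (m div 2)" "m = 2 * (m div 2)" using that by presburger+
    have "2 * 2 ^ k dvd 2 * (m div 2 * n) \<longleftrightarrow> 2 ^ k dvd m div 2 * n"
      by (rule nat_mult_dvd_cancel1) simp
    moreover have "2 * (m div 2 * n) = m * n" using u(2) by (simp only: mult.assoc[symmetric])
    ultimately show ?thesis using *[OF u(1), of k n] by simp
  qed
  show "2 ^ Suc (Suc k) dvd m * n \<longleftrightarrow> 2 ^ k dvd n" if "m mod 8 = 4"
  proof -
    have u: "odd (m div 4)" "m = 4 * (m div 4)" using that by presburger+
    have "4 * 2 ^ k dvd 4 * (m div 4 * n) \<longleftrightarrow> 2 ^ k dvd m div 4 * n"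
      by (rule nat_mult_dvd_cancel1) simp
    moreover have "4 * (m div 4 * n) = m * n" using u(2) by (simp only: mult.assoc[symmetric])
    ultimately show ?thesis using *[OF u(1), of k n] by simp
  qed
qed

text \<open>The theorem separates cases by \<open>m * n\<close> and a gcd, the weights by the
  residues of each factor. The alternatives related by swapping \<open>m\<close> and
  \<open>n\<close> are covered by the symmetry of \<open>Theta\<close>.\<close>

lemma two_adic_product_cases:
  fixes m n :: nat
  defines "N \<equiv> m * n"
  shows "N mod 8 = 4 \<Longrightarrow> odd m \<or> odd n \<Longrightarrow> odd m \<and> n mod 8 = 4 \<or> odd n \<and> m mod 8 = 4"
    and "N mod 8 = 0 \<Longrightarrow> odd m \<or> odd n \<Longrightarrow> odd m \<and> n mod 8 = 0 \<or> odd n \<and> m mod 8 = 0"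
    and "N mod 8 = 4 \<Longrightarrow> even m \<and> even n \<Longrightarrow> m mod 4 = 2 \<and> n mod 4 = 2"
    and "N mod 16 = 8 \<Longrightarrow> even m \<and> even n \<Longrightarrow>
      m mod 4 = 2 \<and> n mod 8 = 4 \<or> n mod 4 = 2 \<and> m mod 8 = 4"
    and "N mod 32 = 0 \<and> even m \<and> even n \<or> N mod 32 = 16 \<and> even m \<and> even n \<and> \<not> (4 dvd m \<and> 4 dvd n) \<Longrightarrow>
      (m mod 4 = 2 \<and> n mod 8 = 0 \<or> n mod 4 = 2 \<and> m mod 8 = 0) \<or>
      N mod 32 = 0 \<and> (m mod 8 = 4 \<and> n mod 8 = 0 \<or> n mod 8 = 4 \<and> m mod 8 = 0) \<or>
      m mod 8 = 0 \<and> n mod 8 = 0"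
    and "N mod 64 = 32 \<Longrightarrow> 4 dvd m \<and> 4 dvd n \<Longrightarrow>
      m mod 8 = 4 \<and> n mod 16 = 8 \<or> n mod 8 = 4 \<and> m mod 16 = 8"
    and "N mod 32 = 16 \<Longrightarrow> 4 dvd m \<and> 4 dvd n \<Longrightarrow> m mod 8 = 4 \<and> n mod 8 = 4"
proof -
  have NC: "n * m = N" by (simp add: N_def mult.commute)
  have odds: "odd m \<Longrightarrow> (4 dvd N \<longleftrightarrow> 4 dvd n) \<and> (8 dvd N \<longleftrightarrow> 8 dvd n)"
    "odd n \<Longrightarrow> (4 dvd N \<longleftrightarrow> 4 dvd m) \<and> (8 dvd N \<longleftrightarrow> 8 dvd m)"
    using dvd_mult_two_adic(1)[of m 2 n] dvd_mult_two_adic(1)[of m 3 n]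
      dvd_mult_two_adic(1)[of n 2 m] dvd_mult_two_adic(1)[of n 3 m] by (simp_all add: NC N_def[symmetric])
  have twos: "m mod 4 = 2 \<Longrightarrow> (8 dvd N \<longleftrightarrow> 4 dvd n) \<and> (16 dvd N \<longleftrightarrow> 8 dvd n)"
    "n mod 4 = 2 \<Longrightarrow> (8 dvd N \<longleftrightarrow> 4 dvd m) \<and> (16 dvd N \<longleftrightarrow> 8 dvd m)"
    using dvd_mult_two_adic(2)[of m 2 n] dvd_mult_two_adic(2)[of m 3 n]
      dvd_mult_two_adic(2)[of n 2 m] dvd_mult_two_adic(2)[of n 3 m] by (simp_all add: NC N_def[symmetric])
  have fours: "m mod 8 = 4 \<Longrightarrow> (32 dvd N \<longleftrightarrow> 8 dvd n) \<and> (64 dvd N \<longleftrightarrow> 16 dvd n)"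
    "n mod 8 = 4 \<Longrightarrow> (32 dvd N \<longleftrightarrow> 8 dvd m) \<and> (64 dvd N \<longleftrightarrow> 16 dvd m)"
    using dvd_mult_two_adic(3)[of m 3 n] dvd_mult_two_adic(3)[of m 4 n]
      dvd_mult_two_adic(3)[of n 3 m] dvd_mult_two_adic(3)[of n 4 m] by (simp_all add: NC N_def[symmetric])
  have prod: "4 dvd m \<Longrightarrow> even n \<Longrightarrow> 8 dvd N" "even m \<Longrightarrow> 4 dvd n \<Longrightarrow> 8 dvd N"
    "4 dvd m \<Longrightarrow> 4 dvd n \<Longrightarrow> 16 dvd N" "8 dvd m \<Longrightarrow> 8 dvd n \<Longrightarrow> 64 dvd N"
    "8 dvd m \<Longrightarrow> 4 dvd n \<Longrightarrow> 32 dvd N" "4 dvd m \<Longrightarrow> 8 dvd n \<Longrightarrow> 32 dvd N"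
    using mult_dvd_mono[of 4 m 2 n] mult_dvd_mono[of 2 m 4 n] mult_dvd_mono[of 4 m 4 n]
      mult_dvd_mono[of 8 m 8 n] mult_dvd_mono[of 8 m 4 n] mult_dvd_mono[of 4 m 8 n]
    by (simp_all add: N_def)
  have res4: "x mod 4 = 2" if "even x" "\<not> 4 dvd x" for x :: nat using that by presburger
  have res8: "x mod 8 = 4" if "4 dvd x" "\<not> 8 dvd x" for x :: nat using that by presburger
  have res16: "x mod 16 = 8" if "8 dvd x" "\<not> 16 dvd x" for x :: nat using that by presburger
  have dvd: "8 dvd x \<Longrightarrow> 4 dvd x" for x :: nat by presburger
  show "odd m \<and> n mod 8 = 4 \<or> odd n \<and> m mod 8 = 4" if "N mod 8 = 4" "odd m \<or> odd n"
  proof -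
    have "4 dvd N" "\<not> 8 dvd N" using that(1) by presburger+
    then show ?thesis using odds res8 that(2) by blast
  qed
  show "odd m \<and> n mod 8 = 0 \<or> odd n \<and> m mod 8 = 0" if "N mod 8 = 0" "odd m \<or> odd n"
    using odds that by auto
  show "m mod 4 = 2 \<and> n mod 4 = 2" if "N mod 8 = 4" "even m \<and> even n"
  proof -
    have "\<not> 8 dvd N" using that(1) by presburger
    then show ?thesis using prod res4 that(2) by blast
  qed
  show "m mod 4 = 2 \<and> n mod 8 = 4 \<or> n mod 4 = 2 \<and> m mod 8 = 4" if "N mod 16 = 8" "even m \<and> even n"
  proof -
    have "8 dvd N" "\<not> 16 dvd N" using that(1) by presburger+
    then show ?thesis using prod(3) twos res4 res8 that(2) by blast
  qed
  show "(m mod 4 = 2 \<and> n mod 8 = 0 \<or> n mod 4 = 2 \<and> m mod 8 = 0) \<or>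
      N mod 32 = 0 \<and> (m mod 8 = 4 \<and> n mod 8 = 0 \<or> n mod 8 = 4 \<and> m mod 8 = 0) \<or>
      m mod 8 = 0 \<and> n mod 8 = 0"
    if "N mod 32 = 0 \<and> even m \<and> even n \<or> N mod 32 = 16 \<and> even m \<and> even n \<and> \<not> (4 dvd m \<and> 4 dvd n)"
  proof -
    have "16 dvd N" "N mod 32 = 0 \<Longrightarrow> 32 dvd N" using that by presburger+
    then show ?thesis
      unfolding mod_eq_0_iff_dvd using twos fours res4 res8 that by blast
  qed
  show "m mod 8 = 4 \<and> n mod 16 = 8 \<or> n mod 8 = 4 \<and> m mod 16 = 8" if "N mod 64 = 32" "4 dvd m \<and> 4 dvd n"
  proof -
    have "32 dvd N" "\<not> 64 dvd N" using that(1) by presburger+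
    then show ?thesis using fours prod(4) res8 res16 that(2) by blast
  qed
  show "m mod 8 = 4 \<and> n mod 8 = 4" if "N mod 32 = 16" "4 dvd m \<and> 4 dvd n"
  proof -
    have "\<not> 32 dvd N" using that(1) by presburger
    then show ?thesis using prod(5,6) res8 that(2) by blast
  qed
qed

lemma Gcd_insert_2:
  fixes m n :: nat
  shows "Gcd {m, n, 2} = (if even m \<and> even n then 2 else 1)"
  by (cases "even m"; cases "even n") (simp_all add: gcd_nat.absorb2 coprime_iff_gcd_eq_1[symmetric])

lemma dvd_Gcd_insert:
  fixes k m n l :: nat
  shows "k dvd Gcd {m, n, l} \<longleftrightarrow> k dvd m \<and> k dvd n \<and> k dvd l"
  by (auto simp: dvd_Gcd_iff)

theorem theorem1p3:
  fixes m n la \<omega> :: nat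
  assumes "0 < m" and "0 < n"
    and "la \<in> {2, 3}"
    and "\<omega> = (if la = 2 then 0 else xi m n)"
  shows
    "(m * n mod 4 \<in> {1, 2, 3} \<longrightarrow>
        int (Theta m n 3 la 1) \<le> \<lfloor>(real (m * n) + 2 * real \<omega>) / 4\<rfloor>) \<and>
     (m * n mod 8 = 0 \<and> Gcd {m, n, 2} = 1 \<longrightarrow>
        int (Theta m n 3 la 1) \<le> \<lfloor>(7 * real (m * n) + 16 * real \<omega>) / 32\<rfloor>) \<and>
     (m * n mod 8 = 4 \<and> Gcd {m, n, 2} = 1 \<and> (m, n) \<notin> {(12, 3), (3, 12)} \<longrightarrow>
        int (Theta m n 3 la 1) \<le> \<lfloor>(7 * real (m * n) + 4 + 16 * real \<omega>) / 32\<rfloor>) \<and>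
     ((m, n) \<in> {(12, 3), (3, 12)} \<longrightarrow>
        real (Theta m n 3 la 1) \<le> 7 + real \<omega> / 2) \<and>
     (m * n mod 8 = 4 \<and> Gcd {m, n, 2} = 2 \<longrightarrow>
        int (Theta m n 3 la 1) \<le> \<lfloor>(5 * real (m * n) + 4 + 8 * real \<omega>) / 24\<rfloor>) \<and>
     (m * n mod 16 = 8 \<and> Gcd {m, n, 2} = 2 \<and> (m, n) \<notin> {(2, 4), (4, 2)} \<and>
      (la = 3 \<longrightarrow> (m, n) \<notin> {(2, 12), (4, 6), (6, 4), (6, 12), (12, 2), (12, 6)}) \<longrightarrow>
        int (Theta m n 3 la 1) \<le> \<lfloor>(13 * real (m * n) + 40 + 32 * real \<omega>) / 64\<rfloor>) \<and>
     ((m, n) \<in> {(2, 4), (4, 2)} \<longrightarrow>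
        Theta m n 3 la 1 \<le> 1) \<and>
     ((m, n) \<in> {(2, 12), (4, 6), (6, 4), (6, 12), (12, 2), (12, 6)} \<and> la = 3 \<longrightarrow>
        int (Theta m n 3 la 1) \<le> \<lfloor>(5 * real (m * n) + 8 + 8 * real \<omega>) / 24\<rfloor>) \<and>
     ((m * n mod 32 = 0 \<and> Gcd {m, n, 2} = 2 \<or> m * n mod 32 = 16 \<and> Gcd {m, n, 4} = 2) \<and>
      \<not> (m * n mod 64 = 32 \<and> Gcd {m, n, 8} = 4 \<and> la = 2) \<longrightarrow>
        int (Theta m n 3 la 1) \<le> \<lfloor>(13 * real (m * n) + 32 + 32 * real \<omega>) / 64\<rfloor>) \<and>
     (m * n mod 64 = 32 \<and> Gcd {m, n, 8} = 4 \<and> la = 2 \<longrightarrow>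
        real (Theta m n 3 la 1) \<le> (13 * real (m * n) - 32) / 64) \<and>
     (m * n mod 32 = 16 \<and> Gcd {m, n, 4} = 4 \<and>
      \<not> (m * n mod 192 = 144 \<and> Gcd {m, n, 4} = 4 \<and> la = 2) \<longrightarrow>
        int (Theta m n 3 la 1) \<le> \<lfloor>(13 * real (m * n) + 48 + 32 * real \<omega>) / 64\<rfloor>) \<and>
     (m * n mod 192 = 144 \<and> Gcd {m, n, 4} = 4 \<and> la = 2 \<longrightarrow>
        real (Theta m n 3 la 1) \<le> (13 * real (m * n) - 16) / 64)"
proof -
  note mn = assms(1,2) and la = assms(3) and \<omega> = assms(4)
  have nm: "0 < n" "0 < m" using mn by simp_all
  have \<omega>': "\<omega> = (if la = 2 then 0 else xi n m)" using \<omega> xi_swap[OF mn] by simp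
  obtain F where F: "OOSPC m n 3 la 1 F" and TF: "card F = Theta m n 3 la 1"
    by (rule Theta_attained[OF mn])
  obtain G where G: "OOSPC n m 3 la 1 G" and TG: "card G = Theta m n 3 la 1"
    using Theta_swap[OF mn] by (metis Theta_attained[OF nm])
  define N T where "N = m * n" and "T = Theta m n 3 la 1"
  note bound = N_def T_def TF TG mult.commute
  have B11: "real T \<le> (real N + 2 * real \<omega>) / 4" if "N mod 4 \<in> {1, 2, 3}"
    using class_card_bound_1_1[OF mn F la \<omega>] that by (simp add: bound)
  have B14: "real T \<le> (7 * real N + 4 + 16 * real \<omega>) / 32"
    if "odd m \<and> n mod 8 = 4 \<or> odd n \<and> m mod 8 = 4"
    using class_card_bound_1_4[OF mn F la \<omega>] class_card_bound_1_4[OF nm G la \<omega>'] that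
    by (auto simp: bound)
  have B18: "real T \<le> (7 * real N + 16 * real \<omega>) / 32"
    if "odd m \<and> n mod 8 = 0 \<or> odd n \<and> m mod 8 = 0"
    using class_card_bound_1_8[OF mn F la \<omega>] class_card_bound_1_8[OF nm G la \<omega>'] that
    by (auto simp: bound)
  have B22: "real T \<le> (5 * real N + 4 + 8 * real \<omega>) / 24" if "m mod 4 = 2 \<and> n mod 4 = 2"
    using class_card_bound_2_2[OF mn F la \<omega>] that by (simp add: bound)
  have B24: "real T \<le> (13 * real N + 40 + 32 * real \<omega>) / 64"
      "real T \<le> (5 * real N + 8 + 8 * real \<omega>) / 24"
    if "m mod 4 = 2 \<and> n mod 8 = 4 \<or> n mod 4 = 2 \<and> m mod 8 = 4"
    using class_card_bound_2_4[OF mn F la \<omega>] class_card_bound_2_4[OF nm G la \<omega>']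
      class_card_bound_2_4_small[OF mn F la \<omega>] class_card_bound_2_4_small[OF nm G la \<omega>'] that
    by (auto simp: bound)
  have B28: "real T \<le> (13 * real N + 32 + 32 * real \<omega>) / 64"
    if "m mod 4 = 2 \<and> n mod 8 = 0 \<or> n mod 4 = 2 \<and> m mod 8 = 0"
    using class_card_bound_2_8[OF mn F la \<omega>] class_card_bound_2_8[OF nm G la \<omega>'] that
    by (auto simp: bound)
  have B44: "real T \<le> (13 * real N + 48 + 32 * real \<omega>) / 64" if "m mod 8 = 4 \<and> n mod 8 = 4"
    using class_card_bound_4_4[OF mn F la \<omega>] that by (simp add: bound)
  have B48: "real T \<le> (39 * real N + 128 + 96 * real \<omega>) / 192"
    if "m mod 8 = 4 \<and> n mod 8 = 0 \<or> n mod 8 = 4 \<and> m mod 8 = 0"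
    using class_card_bound_4_8[OF mn F la \<omega>] class_card_bound_4_8[OF nm G la \<omega>'] that
    by (auto simp: bound)
  have B88: "real T \<le> (13 * real N + 32 + 32 * real \<omega>) / 64" if "m mod 8 = 0 \<and> n mod 8 = 0"
    using class_card_bound_8_8[OF mn F la \<omega>] that by (simp add: bound)
  have S44: "real T < (13 * real N + 48) / 64" if "la = 2" "m mod 8 = 4 \<and> n mod 8 = 4" "3 dvd N"
    using class_card_bound_4_4_la_2[OF mn, of F] F that by (simp add: bound)
  have S48: "real T < (13 * real N + 32) / 64"
    if "la = 2" "m mod 8 = 4 \<and> n mod 16 = 8 \<or> n mod 8 = 4 \<and> m mod 16 = 8"
    using class_card_bound_4_8_la_2[OF mn, of F] class_card_bound_4_8_la_2[OF nm, of G] F G that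
    by (auto simp: bound)
  have S24: "T \<le> 1" if "(m, n) \<in> {(2, 4), (4, 2)}"
    using card_OOSPC_2_4[OF _ la, of F] card_OOSPC_2_4[OF _ la, of G] F G that by (auto simp: bound)
  have S312: "T \<le> 9" "la = 2 \<Longrightarrow> T \<le> 7" "la = 3 \<Longrightarrow> 4 \<le> \<omega>" if "(m, n) \<in> {(12, 3), (3, 12)}"
    using card_OOSPC_3_12[OF _ la, of F] card_OOSPC_3_12[OF _ la, of G]
      card_OOSPC_3_12_la_2[of F] card_OOSPC_3_12_la_2[of G] F G xi_3_12 \<omega> \<omega>' that by (auto simp: bound)

  have G2: "Gcd {m, n, 2} = 1 \<longleftrightarrow> odd m \<or> odd n" "Gcd {m, n, 2} = 2 \<longleftrightarrow> even m \<and> even n"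
    unfolding Gcd_insert_2 by auto
  have G4: "4 dvd m \<and> 4 dvd n" if "Gcd {m, n, 4} = 4 \<or> Gcd {m, n, 8} = 4"
    using that dvd_Gcd_insert[of 4 m n 4] dvd_Gcd_insert[of 4 m n 8] by (metis dvd_refl)
  have G42: "even m \<and> even n \<and> \<not> (4 dvd m \<and> 4 dvd n)" if "Gcd {m, n, 4} = 2"
  proof -
    have "2 dvd Gcd {m, n, 4}" "\<not> 4 dvd Gcd {m, n, 4}" unfolding that by simp_all
    then show ?thesis unfolding dvd_Gcd_insert by simp
  qed
  note cases = two_adic_product_cases[of m n, folded N_def]
  have "N mod 4 \<in> {1, 2, 3} \<longrightarrow> int T \<le> \<lfloor>(real N + 2 * real \<omega>) / 4\<rfloor>"
    using B11 by (simp add: le_floor_iff)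
  moreover have "N mod 8 = 0 \<and> Gcd {m, n, 2} = 1 \<longrightarrow> int T \<le> \<lfloor>(7 * real N + 16 * real \<omega>) / 32\<rfloor>"
    using B18 cases(2) G2(1) by (simp add: le_floor_iff)
  moreover have "N mod 8 = 4 \<and> Gcd {m, n, 2} = 1 \<and> (m, n) \<notin> {(12, 3), (3, 12)} \<longrightarrow>
      int T \<le> \<lfloor>(7 * real N + 4 + 16 * real \<omega>) / 32\<rfloor>"
    using B14 cases(1) G2(1) by (simp add: le_floor_iff)
  moreover have "(m, n) \<in> {(12, 3), (3, 12)} \<longrightarrow> real T \<le> 7 + real \<omega> / 2"
  proof
    assume "(m, n) \<in> {(12, 3), (3, 12)}"
    from S312[OF this] la show "real T \<le> 7 + real \<omega> / 2" by auto
  qed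
  moreover have "N mod 8 = 4 \<and> Gcd {m, n, 2} = 2 \<longrightarrow> int T \<le> \<lfloor>(5 * real N + 4 + 8 * real \<omega>) / 24\<rfloor>"
    using B22 cases(3) G2(2) by (simp add: le_floor_iff)
  moreover have "N mod 16 = 8 \<and> Gcd {m, n, 2} = 2 \<and> (m, n) \<notin> {(2, 4), (4, 2)} \<and>
      (la = 3 \<longrightarrow> (m, n) \<notin> {(2, 12), (4, 6), (6, 4), (6, 12), (12, 2), (12, 6)}) \<longrightarrow>
      int T \<le> \<lfloor>(13 * real N + 40 + 32 * real \<omega>) / 64\<rfloor>"
    using B24(1) cases(4) G2(2) by (simp add: le_floor_iff)
  moreover have "(m, n) \<in> {(2, 4), (4, 2)} \<longrightarrow> T \<le> 1"
    using S24 by blast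
  moreover have "(m, n) \<in> {(2, 12), (4, 6), (6, 4), (6, 12), (12, 2), (12, 6)} \<and> la = 3 \<longrightarrow>
      int T \<le> \<lfloor>(5 * real N + 8 + 8 * real \<omega>) / 24\<rfloor>"
  proof
    assume "(m, n) \<in> {(2, 12), (4, 6), (6, 4), (6, 12), (12, 2), (12, 6)} \<and> la = 3"
    then have "m mod 4 = 2 \<and> n mod 8 = 4 \<or> n mod 4 = 2 \<and> m mod 8 = 4" by auto
    from B24(2)[OF this] show "int T \<le> \<lfloor>(5 * real N + 8 + 8 * real \<omega>) / 24\<rfloor>"
      by (simp add: le_floor_iff)
  qed
  moreover have "(N mod 32 = 0 \<and> Gcd {m, n, 2} = 2 \<or> N mod 32 = 16 \<and> Gcd {m, n, 4} = 2) \<and>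
      \<not> (N mod 64 = 32 \<and> Gcd {m, n, 8} = 4 \<and> la = 2) \<longrightarrow>
      int T \<le> \<lfloor>(13 * real N + 32 + 32 * real \<omega>) / 64\<rfloor>"
  proof
    assume h: "(N mod 32 = 0 \<and> Gcd {m, n, 2} = 2 \<or> N mod 32 = 16 \<and> Gcd {m, n, 4} = 2) \<and>
      \<not> (N mod 64 = 32 \<and> Gcd {m, n, 8} = 4 \<and> la = 2)"
    \<comment> \<open>The surplus is 2/3 rather than 1/2 here, but rounding absorbs the difference.\<close>
    have "real T \<le> (13 * real N + 32 + 32 * real \<omega>) / 64"
      if "N mod 32 = 0" "m mod 8 = 4 \<and> n mod 8 = 0 \<or> n mod 8 = 4 \<and> m mod 8 = 0"
    proof -
      obtain q where q: "N = 32 * q" using \<open>N mod 32 = 0\<close> by auto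
      have "6 * real T \<le> 39 * real q + 3 * real \<omega> + 4" using B48[OF that(2)] by (simp add: q)
      then have "6 * T \<le> 39 * q + 3 * \<omega> + 4" by linarith
      then have "2 * T \<le> 13 * q + \<omega> + 1" by presburger
      then have "2 * real T \<le> 13 * real q + real \<omega> + 1" by linarith
      then show ?thesis by (simp add: q)
    qed
    note B48' = this
    from h have "N mod 32 = 0 \<and> even m \<and> even n \<or>
        N mod 32 = 16 \<and> even m \<and> even n \<and> \<not> (4 dvd m \<and> 4 dvd n)"
      unfolding G2(2) using G42 by blast
    from cases(5)[OF this] have "real T \<le> (13 * real N + 32 + 32 * real \<omega>) / 64"
    proof (elim disjE)
      assume "N mod 32 = 0 \<and> (m mod 8 = 4 \<and> n mod 8 = 0 \<or> n mod 8 = 4 \<and> m mod 8 = 0)"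
      then show ?thesis by (elim conjE) (rule B48')
    qed (simp_all only: B28 B88 simp_thms)
    then show "int T \<le> \<lfloor>(13 * real N + 32 + 32 * real \<omega>) / 64\<rfloor>" by (simp add: le_floor_iff)
  qed
  moreover have "N mod 64 = 32 \<and> Gcd {m, n, 8} = 4 \<and> la = 2 \<longrightarrow> real T \<le> (13 * real N - 32) / 64"
  proof
    assume h: "N mod 64 = 32 \<and> Gcd {m, n, 8} = 4 \<and> la = 2"
    then have two: "la = 2" and N: "N mod 64 = 32" and dvd: "4 dvd m \<and> 4 dvd n" using G4 by blast+
    have lt: "real T < (13 * real N + 32) / 64" by (rule S48[OF two cases(6)[OF N dvd]])
    obtain q where q: "N = 64 * q + 32" using h by (metis mult_div_mod_eq)
    \<comment> \<open>For \<open>N = 64 * q + 32\<close> the strict bound is the integer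
      \<open>13 * q + 7\<close>, so strictness gains a whole unit.\<close>
    have "T < 13 * q + 7" using lt by (simp add: q)
    then show "real T \<le> (13 * real N - 32) / 64" by (simp add: q)
  qed
  moreover have "N mod 32 = 16 \<and> Gcd {m, n, 4} = 4 \<and>
      \<not> (N mod 192 = 144 \<and> Gcd {m, n, 4} = 4 \<and> la = 2) \<longrightarrow>
      int T \<le> \<lfloor>(13 * real N + 48 + 32 * real \<omega>) / 64\<rfloor>"
  proof
    assume "N mod 32 = 16 \<and> Gcd {m, n, 4} = 4 \<and> \<not> (N mod 192 = 144 \<and> Gcd {m, n, 4} = 4 \<and> la = 2)"
    then have N: "N mod 32 = 16" and dvd: "4 dvd m \<and> 4 dvd n" using G4 by blast+
    from B44[OF cases(7)[OF N dvd]] show "int T \<le> \<lfloor>(13 * real N + 48 + 32 * real \<omega>) / 64\<rfloor>"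
      by (simp add: le_floor_iff)
  qed
  moreover have "N mod 192 = 144 \<and> Gcd {m, n, 4} = 4 \<and> la = 2 \<longrightarrow> real T \<le> (13 * real N - 16) / 64"
  proof
    assume h: "N mod 192 = 144 \<and> Gcd {m, n, 4} = 4 \<and> la = 2"
    obtain q where q: "N = 192 * q + 144" using h by (metis mult_div_mod_eq)
    have N: "N mod 32 = 16" "3 dvd N" unfolding q by presburger+
    have two: "la = 2" and dvd: "4 dvd m \<and> 4 dvd n" using h G4 by blast+
    have "real T < (13 * real N + 48) / 64" by (rule S44[OF two cases(7)[OF N(1) dvd] N(2)])
    \<comment> \<open>Again an integer: \<open>(13 * N + 48) / 64 = 39 * q + 30\<close>.\<close>
    then have "T < 39 * q + 30" by (simp add: q)
    then show "real T \<le> (13 * real N - 16) / 64" by (simp add: q)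
  qed
  ultimately show ?thesis unfolding N_def T_def by (intro conjI)
qed

end
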